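(* Let $M\in\mathbb{R}^{m\times n}$ with $\operatorname{rank}(M)\ge r+1$, where $r\ge1$, and let $\widehat{M}$ be a maximal volume pseudo skeleton approximation of $M$ (of rank at most $r$) with parameters $p=r$ and $q$, where $q=\alpha r-1$ for some rational $\alpha>1$ (with $q$ an integer). Suppose that the singular values $\sigma_k=\sigma_k(M)$ satisfy $$\frac{C_1}{k^{2s}}\le\sigma_k^2\le\frac{C_2}{k^{2s}}\qquad\text{for } k=1,2,\ldots,\min(m,n),$$ for some $C_1,C_2>0$ and some $s>0$. Then $$\left\|\widehat{M}-M\right\|_C^2\le\frac{\alpha}{\alpha-1}\,\frac{C_2}{C_1}\,(2s+1)\,\sigma_{r+1}(M)^2.$$
   Context: Chebyshev norm: $\|X\|_C=\max_{i,j}|X_{i,j}|$. Singular values are ordered decreasingly, $\sigma_1(M)\ge\sigma_2(M)\ge\cdots$. Pseudo skeleton approximation: let $M\in\mathbb{R}^{m\times n}$ and let $P_1\in\mathbb{R}^{m\times m}$, $P_2\in\mathbb{R}^{n\times n}$ be permutation matrices with $P_1MP_2^T=\begin{bmatrix}A&B\\C&D\end{bmatrix}$, $A\in\mathbb{R}^{p\times q}$ ($p\le m$, $q\le n$). With $A^+$ the Moore-Penrose inverse of $A$, the matrix $\widehat{M}=P_1^T\begin{bmatrix}A\\C\end{bmatrix}A^+\begin{bmatrix}A&B\end{bmatrix}P_2$ is called a pseudo skeleton approximation of $M$ with parameters $p,q$. It is called a maximal volume approximation if $P_1,P_2$ are chosen (among all pairs of permutations) so that $\rho=\operatorname{rank}(A)$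 is maximal and, subject to this, the $\rho$-volume $\operatorname{vol}_\rho(A)=\sigma_1(A)\cdots\sigma_\rho(A)$ is maximal. *)

theory Defs
  imports
    "Jordan_Normal_Form.Char_Poly"
    "Jordan_Normal_Form.DL_Rank"
begin

definition mat_rank :: "real mat \<Rightarrow> nat" where
  "mat_rank A = vec_space.rank (dim_row A) A"

definition chebyshev_norm :: "real mat \<Rightarrow> real" where
  "chebyshev_norm X =
     Max ((\<lambda>(i, j). \<bar>X $$ (i, j)\<bar>) ` ({..<dim_row X} \<times> {..<dim_col X}))"

text \<open>
  The \<open>k\<close>-th largest singular value, counted from \<open>k = 1\<close>: the square root of the \<open>k\<close>-th largest
  eigenvalue of the symmetric matrix \<open>A\<^sup>T A\<close>, with multiplicity. Its characteristic polynomial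
  splits over the reals, so \<open>proots\<close> yields all \<open>dim_col A\<close> eigenvalues. The value is meaningful
  for \<open>1 \<le> k \<le> dim_col A\<close>, and it is \<open>0\<close> for \<open>dim_row A < k \<le> dim_col A\<close>.
\<close>
definition singular_value :: "real mat \<Rightarrow> nat \<Rightarrow> real" where
  "singular_value A k =
     sqrt (rev (sorted_list_of_multiset (proots (char_poly (A\<^sup>T * A)))) ! (k - 1))"

definition volume :: "nat \<Rightarrow> real mat \<Rightarrow> real" where
  "volume \<rho> A = (\<Prod>k = 1..\<rho>. singular_value A k)"

definition is_pseudo_inverse :: "real mat \<Rightarrow> real mat \<Rightarrow> bool" where
  "is_pseudo_inverse A X \<longleftrightarrow>
     X \<in> carrier_mat (dim_col A) (dim_row A) \<and>
     A * X * A = A \<and> X * A * X = X \<and> (A * X)\<^sup>T = A * X \<and> (X * A)\<^sup>T = X * A"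

definition pseudo_inverse :: "real mat \<Rightarrow> real mat" where
  "pseudo_inverse A = (THE X. is_pseudo_inverse A X)"

definition permutation_mat :: "nat \<Rightarrow> real mat \<Rightarrow> bool" where
  "permutation_mat n P \<longleftrightarrow>
     (\<exists>\<pi>. \<pi> permutes {..<n} \<and> P = mat n n (\<lambda>(i, j). if j = \<pi> i then 1 else 0))"

text \<open>Horizontal concatenation, the column counterpart of \<open>append_rows\<close>.\<close>
definition append_columns :: "real mat \<Rightarrow> real mat \<Rightarrow> real mat" where
  "append_columns A B = four_block_mat A B (0\<^sub>m 0 (dim_col A)) (0\<^sub>m 0 (dim_col B))"

definition leading_block :: "real mat \<Rightarrow> nat \<Rightarrow> nat \<Rightarrow> real mat \<Rightarrow> real mat \<Rightarrow> real mat" where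
  "leading_block M p q P1 P2 =
     (case split_block (P1 * M * P2\<^sup>T) p q of (A, B, C, D) \<Rightarrow> A)"

definition pseudo_skeleton :: "real mat \<Rightarrow> nat \<Rightarrow> nat \<Rightarrow> real mat \<Rightarrow> real mat \<Rightarrow> real mat" where
  "pseudo_skeleton M p q P1 P2 =
     (case split_block (P1 * M * P2\<^sup>T) p q of (A, B, C, D) \<Rightarrow>
        P1\<^sup>T * (A @\<^sub>r C) * pseudo_inverse A * append_columns A B * P2)"

text \<open>Lexicographic maximality of the pair (rank, volume) over all pairs of permutation matrices.\<close>
definition max_volume_pair :: "real mat \<Rightarrow> nat \<Rightarrow> nat \<Rightarrow> real mat \<Rightarrow> real mat \<Rightarrow> bool" where
  "max_volume_pair M p q P1 P2 \<longleftrightarrow>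
     permutation_mat (dim_row M) P1 \<and> permutation_mat (dim_col M) P2 \<and>
     (\<forall>Q1 Q2. permutation_mat (dim_row M) Q1 \<longrightarrow> permutation_mat (dim_col M) Q2 \<longrightarrow>
        (let A = leading_block M p q P1 P2; A' = leading_block M p q Q1 Q2; \<rho> = mat_rank A
         in mat_rank A' < \<rho> \<or> (mat_rank A' = \<rho> \<and> volume \<rho> A' \<le> volume \<rho> A)))"

definition max_volume_approximation ::
    "real mat \<Rightarrow> nat \<Rightarrow> nat \<Rightarrow> real mat \<Rightarrow> bool" where
  "max_volume_approximation M p q Mhat \<longleftrightarrow>
     p \<le> dim_row M \<and> q \<le> dim_col M \<and>
     (\<exists>P1 P2. max_volume_pair M p q P1 P2 \<and> Mhat = pseudo_skeleton M p q P1 P2)"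

end

theory Submission
  imports Defs "Jordan_Normal_Form.Schur_Decomposition" "HOL-Computational_Algebra.Fundamental_Theorem_Algebra"
begin

text \<open>
  Let \<open>A\<close> be the chosen \<open>r \<times> q\<close> block; it has rank \<open>r\<close>, and \<open>det (A A\<^sup>T)\<close>, the square of its
  \<open>r\<close>-volume, is maximal among all \<open>r \<times> q\<close> submatrices of \<open>M\<close>. Let \<open>\<gamma>\<close> be an entry of the error and
  \<open>D\<close> the submatrix obtained from \<open>A\<close> by adding the row of that entry, and its column unless
  that column already meets \<open>A\<close>. A kernel vector of the first \<open>r\<close> rows of \<open>D\<close> shows
  \<open>\<gamma>\<^sup>2 det (A A\<^sup>T) \<le> det (D D\<^sup>T)\<close>. Conversely, deleting a row from \<open>D\<close> leaves a matrix with at most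
  \<open>q + 1\<close> columns, whose Gram determinant is the sum of those of its column deletions divided by
  \<open>q + 1 - r\<close>, hence at most \<open>(q + 1) / (q + 1 - r) det (A A\<^sup>T)\<close>. Since the principal minors of
  \<open>D D\<^sup>T\<close> of order \<open>r\<close> add up to \<open>det (D D\<^sup>T) \<Sum>\<^sub>k \<sigma>\<^sub>k(D)\<^sup>-\<^sup>2\<close>, and \<open>\<sigma>\<^sub>k(D) \<le> \<sigma>\<^sub>k(M)\<close>, this gives
  \<open>\<gamma>\<^sup>2 \<Sum>\<^sub>k \<sigma>\<^sub>k(M)\<^sup>-\<^sup>2 \<le> (r + 1) (q + 1) / (q + 1 - r)\<close>, the sum being over \<open>k \<le> r + 1\<close>. Here
  \<open>(q + 1) / (q + 1 - r) = \<alpha> / (\<alpha> - 1)\<close>, and the decay of the singular values bounds the sum from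
  below by comparison with \<open>\<integral> x\<^sup>2\<^sup>s dx\<close>.
\<close>

subsection \<open>Real symmetric matrices\<close>

lemma scalar_prod_self_sum: "(v :: real vec) \<bullet> v = (\<Sum>i<dim_vec v. (v $ i)\<^sup>2)"
  by (simp add: scalar_prod_def power2_eq_square atLeast0LessThan)

lemma scalar_prod_self_nonneg: "(v :: real vec) \<bullet> v \<ge> 0"
  unfolding scalar_prod_self_sum by (simp add: sum_nonneg)

lemma scalar_prod_self_eq_0: "v \<in> carrier_vec n \<Longrightarrow> (v :: real vec) \<bullet> v = 0 \<longleftrightarrow> v = 0\<^sub>v n"
  unfolding scalar_prod_self_sum by (subst sum_nonneg_eq_0_iff) (auto intro!: eq_vecI)

section \<open>Spectral theorem for real symmetric matrices\<close>

text \<open>For an eigenvector \<open>w\<close>, the Hermitian form \<open>T\<close> of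
  \<open>S\<close> at \<open>w\<close> is \<open>z\<close> times the squared norm \<open>N\<close>,
  and \<open>T\<close> is its own conjugate because \<open>S\<close> is real and symmetric. Roots
  are taken over the complex numbers since that is where the fundamental theorem of algebra provides
  them.\<close>

lemma symmetric_complex_eigenvalue_real:
  fixes S :: "real mat"
  assumes S: "S \<in> carrier_mat n n" "S\<^sup>T = S"
    and z: "poly (map_poly complex_of_real (char_poly S)) z = 0"
  shows "z \<in> \<real>"
proof -
  let ?S = "map_mat complex_of_real S"
  have S': "?S \<in> carrier_mat n n" using S by simp
  have "char_poly ?S = map_poly complex_of_real (char_poly S)"
    using of_real_hom.char_poly_hom[OF S(1)] by simp
  then have "eigenvalue ?S z" using z eigenvalue_root_char_poly[OF S'] by simp
  then obtain w where w: "w \<in> carrier_vec n" "w \<noteq> 0\<^sub>v n" "?S *\<^sub>v w = z \<cdot>\<^sub>v w"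
    unfolding eigenvalue_def eigenvector_def using S by auto
  define N where "N = (\<Sum>i<n. cmod (w $ i) ^ 2)"
  define T where "T = (\<Sum>i<n. \<Sum>j<n. complex_of_real (S $$ (i,j)) * w $ j * cnj (w $ i))"
  have ev: "(\<Sum>j<n. complex_of_real (S $$ (i,j)) * w $ j) = z * w $ i" if "i < n" for i
  proof -
    have "(?S *\<^sub>v w) $ i = z * w $ i" using w that by simp
    then show ?thesis using S w(1) that by (simp add: scalar_prod_def atLeast0LessThan)
  qed
  have "T = (\<Sum>i<n. z * w $ i * cnj (w $ i))"
    unfolding T_def by (simp add: sum_distrib_right[symmetric] ev)
  also have "\<dots> = z * of_real N"
    unfolding N_def of_real_sum sum_distrib_left
    by (intro sum.cong) (auto simp only: mult.assoc complex_norm_square[symmetric] of_real_power)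
  finally have 1: "T = z * of_real N" .
  have "cnj T = (\<Sum>i<n. \<Sum>j<n. complex_of_real (S $$ (i,j)) * cnj (w $ j) * w $ i)"
    unfolding T_def by simp
  also have "\<dots> = (\<Sum>j<n. \<Sum>i<n. complex_of_real (S $$ (i,j)) * cnj (w $ j) * w $ i)"
    by (rule sum.swap)
  also have "\<dots> = T" unfolding T_def
  proof (intro sum.cong refl)
    fix i j assume "i \<in> {..<n}" "j \<in> {..<n}"
    then have "S $$ (j,i) = S $$ (i,j)" using S by (metis index_transpose_mat(1) carrier_matD lessThan_iff)
    then show "complex_of_real (S $$ (j,i)) * cnj (w $ i) * w $ j = complex_of_real (S $$ (i,j)) * w $ j * cnj (w $ i)"
      by simp
  qed
  finally have 2: "cnj z * of_real N = z * of_real N" using 1 by simp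
  have "N \<noteq> 0"
  proof
    assume "N = 0"
    then have "\<forall>i<n. w $ i = 0" unfolding N_def by (subst (asm) sum_nonneg_eq_0_iff) auto
    then have "w = 0\<^sub>v n" using w(1) by (intro eq_vecI) auto
    then show False using w(2) by simp
  qed
  then show ?thesis using 2 by (simp add: Reals_cnj_iff)
qed

text \<open>A root exists over the complex numbers, the hypothesis makes it real, and the quotient
  by its linear factor is again monic with only real roots.\<close>

lemma real_rooted_factorization:
  fixes p :: "real poly"
  assumes "monic p" "\<And>z. poly (map_poly complex_of_real p) z = 0 \<Longrightarrow> z \<in> \<real>"
  shows "\<exists>es. p = (\<Prod>e\<leftarrow>es. [:- e, 1:])"
  using assms
proof (induction "degree p" arbitrary: p)
  case 0
  then have "p = 1" using monic_degree_0[of p] by metis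
  then show ?case by (intro exI[of _ "[]"]) simp
next
  case (Suc d)
  interpret h: map_poly_comm_ring_hom complex_of_real by unfold_locales auto
  have "\<not> constant (poly (map_poly complex_of_real p))"
    using Suc(2) by (simp add: constant_degree)
  then obtain z where z: "poly (map_poly complex_of_real p) z = 0"
    using fundamental_theorem_of_algebra by blast
  then obtain x where x: "z = complex_of_real x" using Suc(4) Reals_cases by blast
  have "poly (map_poly complex_of_real p) (complex_of_real x) = of_real (poly p x)"
    by simp
  then have "poly p x = 0" using z x by simp
  then obtain q where q: "p = [:-x, 1:] * q" by (metis dvdE poly_eq_0_iff_dvd)
  have mq: "monic q" using Suc(3) lead_coeff_mult[of "[:-x, 1:]" q] unfolding q by simp
  then have "q \<noteq> 0" by auto
  then have "degree p = Suc (degree q)" using degree_mult_eq[of "[:-x, 1:]" q] unfolding q by simp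
  then have d: "d = degree q" using Suc(2) by simp
  have "\<exists>es. q = (\<Prod>e\<leftarrow>es. [:- e, 1:])"
  proof (rule Suc(1)[OF d mq])
    fix z assume "poly (map_poly complex_of_real q) z = 0"
    then have "poly (map_poly complex_of_real p) z = 0" unfolding q h.hom_mult by simp
    then show "z \<in> \<real>" by (rule Suc(4))
  qed
  then obtain es where "q = (\<Prod>e\<leftarrow>es. [:- e, 1:])" by blast
  then show ?case using q by (intro exI[of _ "x # es"]) simp
qed

text \<open>Gram-Schmidt applied to a basis starting with \<open>v\<close> leaves \<open>v\<close>
  unchanged; normalising the resulting vectors gives the columns of \<open>W\<close>, so
  \<open>c\<close> is the reciprocal norm of \<open>v\<close>.\<close>

lemma orthonormal_extension:
  fixes v :: "real vec"
  assumes v: "v \<in> carrier_vec n" "v \<noteq> 0\<^sub>v n"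
  shows "\<exists>W c. W \<in> carrier_mat n n \<and> W\<^sup>T * W = 1\<^sub>m n \<and> col W 0 = c \<cdot>\<^sub>v v"
proof -
  interpret cof_vec_space n "TYPE(real)" .
  define b where "b = basis_completion v"
  define ws where "ws = gram_schmidt n b"
  have n: "0 < n" using v by (cases n) auto
  note bc = basis_completion[OF v, folded b_def]
  obtain vs where bv: "b = v # vs" using bc(6,7) n by (cases b) auto
  note gs = gram_schmidt_result[OF bc(2) bc(4) bc(5) refl, folded ws_def]
  have hdws: "hd ws = v" using gram_schmidt_hd[OF v(1), of vs, folded bv] unfolding ws_def .
  have len: "length ws = n" using gs(4) bc(6) by simp
  have ws0: "ws ! 0 = v" using hdws len n by (metis hd_conv_nth length_greater_0_conv)
  define nr where "nr = (\<lambda>j. sqrt ((ws ! j) \<bullet> (ws ! j)))"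
  have wsc: "ws ! j \<in> carrier_vec n" if "j < n" for j using gs(3) that len by auto
  have conj: "conjugate (u :: real vec) = u" for u by (intro eq_vecI) auto
  \<comment> \<open>The case \<open>i = j\<close> says that no vector is null, which makes the
    division by \<open>nr\<close> legitimate.\<close>
  have orth: "(ws ! i \<bullet> ws ! j = 0) = (i \<noteq> j)" if "i < n" "j < n" for i j
    using corthogonalD[OF gs(2), of i j] that len by (simp add: conj)
  define W where "W = mat n n (\<lambda>(i,j). (ws ! j) $ i / nr j)"
  have W: "W \<in> carrier_mat n n" unfolding W_def by simp
  have "W\<^sup>T * W = 1\<^sub>m n"
  proof (rule eq_matI)
    fix i j assume "i < dim_row (1\<^sub>m n :: real mat)" "j < dim_col (1\<^sub>m n :: real mat)"
    then have ij: "i < n" "j < n" by auto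
    have "(W\<^sup>T * W) $$ (i,j) = (\<Sum>k<n. (ws ! i) $ k / nr i * ((ws ! j) $ k / nr j))"
      using ij W unfolding W_def by (simp add: scalar_prod_def atLeast0LessThan)
    also have "\<dots> = (ws ! i \<bullet> ws ! j) / (nr i * nr j)"
      using wsc[OF ij(2)] by (simp add: scalar_prod_def sum_divide_distrib atLeast0LessThan)
    also have "\<dots> = 1\<^sub>m n $$ (i,j)"
      using orth[OF ij] orth[OF ij(1) ij(1)] ij scalar_prod_self_nonneg[of "ws ! i"]
      by (auto simp: nr_def)
    finally show "(W\<^sup>T * W) $$ (i,j) = 1\<^sub>m n $$ (i,j)" .
  qed (use W in auto)
  moreover have "col W 0 = (1 / nr 0) \<cdot>\<^sub>v v"
    by (rule eq_vecI) (use v n ws0 in \<open>auto simp: W_def\<close>)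
  ultimately show ?thesis using W by blast
qed

lemma mat_sandwich_transpose:
  fixes S W :: "real mat"
  assumes "S \<in> carrier_mat n n" "S\<^sup>T = S" "W \<in> carrier_mat n k"
  shows "(W\<^sup>T * S * W)\<^sup>T = W\<^sup>T * S * W"
  using assms by (simp add: transpose_mult[of _ k n] transpose_mult[of _ n n] transpose_mult[of _ k n _ k] assoc_mult_mat[of _ k n])

text \<open>Deflation: in an orthonormal basis that starts with an eigenvector for \<open>e\<close>,
  the matrix splits into the 1 by 1 block \<open>e\<close> and a smaller symmetric block whose
  eigenvalues are the rest of the list. Fixing the list in advance fixes the order of the
  diagonal.\<close>

lemma spectral_theorem_list:
  fixes S :: "real mat"
  assumes "S \<in> carrier_mat n n" "S\<^sup>T = S" "char_poly S = (\<Prod>e\<leftarrow>es. [:- e, 1:])"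
  shows "\<exists>P. P \<in> carrier_mat n n \<and> P\<^sup>T * P = 1\<^sub>m n \<and> P\<^sup>T * S * P = mat_diag n (\<lambda>i. es ! i)"
  using assms
proof (induction es arbitrary: n S)
  case Nil
  then have "n = 0" using degree_monic_char_poly[of S n] by simp
  then show ?case using Nil by (intro exI[of _ "1\<^sub>m 0"]) (auto simp: mat_diag_def intro!: eq_matI)
next
  case (Cons e es)
  note S = Cons(2,3)
  let ?m = "n - 1"
  have "poly (char_poly S) e = 0" unfolding Cons(4) by simp
  then have "eigenvalue S e" using eigenvalue_root_char_poly[OF S(1)] by simp
  then obtain v where v: "v \<in> carrier_vec n" "v \<noteq> 0\<^sub>v n" and ev: "S *\<^sub>v v = e \<cdot>\<^sub>v v"
    unfolding eigenvalue_def eigenvector_def using S by auto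
  have n: "0 < n" using v by (cases n) auto
  obtain W c where W: "W \<in> carrier_mat n n" and WW: "W\<^sup>T * W = 1\<^sub>m n" and c: "col W 0 = c \<cdot>\<^sub>v v"
    using orthonormal_extension[OF v] by blast
  have WW': "W * W\<^sup>T = 1\<^sub>m n" using mat_mult_left_right_inverse[OF _ W WW] W by simp
  define A where "A = W\<^sup>T * S * W"
  have A: "A \<in> carrier_mat n n" using S W unfolding A_def by simp
  have At: "A\<^sup>T = A" unfolding A_def by (rule mat_sandwich_transpose[OF S W])
  have "similar_mat_wit A S (W\<^sup>T) W"
    by (rule similar_mat_witI[of _ _ n]) (use W WW WW' S A in \<open>auto simp: A_def\<close>)
  then have cp: "char_poly A = char_poly S" by (intro char_poly_similar) (auto simp: similar_mat_def)
  \<comment> \<open>The first column of \<open>W\<close> is an eigenvector orthogonal to the other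
    columns, so the first column of \<open>A\<close> is \<open>e\<close> times a unit vector;
    symmetry of \<open>A\<close> carries this over to the first row.\<close>
  have A0: "A $$ (i, 0) = (if i = 0 then e else 0)" if i: "i < n" for i
  proof -
    have "S *\<^sub>v col W 0 = e \<cdot>\<^sub>v col W 0"
      unfolding c using S v ev by (simp add: mult_mat_vec smult_smult_assoc mult.commute)
    then have "col (S * W) 0 = e \<cdot>\<^sub>v col W 0" unfolding col_mult2[OF S(1) W n] .
    moreover have "A $$ (i,0) = row (W\<^sup>T) i \<bullet> col (S * W) 0"
      unfolding A_def using S W i n by (simp add: assoc_mult_mat[of _ n n _ n _ n])
    ultimately have "A $$ (i,0) = e * (row (W\<^sup>T) i \<bullet> col W 0)" using W i n by simp
    also have "row (W\<^sup>T) i \<bullet> col W 0 = (W\<^sup>T * W) $$ (i,0)" using W i n by simp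
    also have "\<dots> = (if i = 0 then 1 else 0)" using WW i n by simp
    finally show ?thesis by simp
  qed
  have A0': "A $$ (0, j) = (if j = 0 then e else 0)" if j: "j < n" for j
    using A0[OF j] A At j n by (metis index_transpose_mat(1) carrier_matD)
  define A3 where "A3 = mat ?m ?m (\<lambda>(i,j). A $$ (Suc i, Suc j))"
  have A3: "A3 \<in> carrier_mat ?m ?m" unfolding A3_def by simp
  have A3t: "A3\<^sup>T = A3"
  proof (rule eq_matI)
    fix i j assume "i < dim_row A3" "j < dim_col A3"
    then have ij: "Suc i < n" "Suc j < n" unfolding A3_def by auto
    then have "A $$ (Suc j, Suc i) = A $$ (Suc i, Suc j)"
      using A At by (metis index_transpose_mat(1) carrier_matD)
    then show "A3\<^sup>T $$ (i,j) = A3 $$ (i,j)" using ij unfolding A3_def by auto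
  qed (auto simp: A3_def)
  let ?E = "mat 1 1 (\<lambda>_. e)"
  have Ablock: "A = four_block_mat ?E (0\<^sub>m 1 ?m) (0\<^sub>m ?m 1) A3"
    by (rule eq_matI) (use A n A0 A0' in \<open>auto simp: A3_def\<close>)
  have "char_poly A = char_poly ?E * char_poly A3"
    unfolding Ablock by (rule char_poly_four_block_zeros_col[OF _ _ A3]) auto
  moreover have "char_poly ?E = [:- e, 1:]" by (simp add: char_poly_defs det_def sign_def)
  ultimately have "[:- e, 1:] * char_poly A3 = [:- e, 1:] * (\<Prod>e\<leftarrow>es. [:- e, 1:])"
    using Cons(4) cp by simp
  then have "char_poly A3 = (\<Prod>e\<leftarrow>es. [:- e, 1:])" by (metis mult_cancel_left pCons_eq_0_iff zero_neq_one)
  from Cons(1)[OF A3 A3t this] obtain P where P: "P \<in> carrier_mat ?m ?m" "P\<^sup>T * P = 1\<^sub>m ?m"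
    and PD: "P\<^sup>T * A3 * P = mat_diag ?m (\<lambda>i. es ! i)" by blast
  define Q where "Q = four_block_mat (1\<^sub>m 1) (0\<^sub>m 1 ?m) (0\<^sub>m ?m 1) P"
  have nm: "1 + ?m = n" "Suc (n - Suc 0) = n" using n by auto
  have Q: "Q \<in> carrier_mat n n" unfolding Q_def using P(1) nm by (metis four_block_carrier_mat one_carrier_mat)
  have Qt: "Q\<^sup>T = four_block_mat (1\<^sub>m 1) (0\<^sub>m 1 ?m) (0\<^sub>m ?m 1) (P\<^sup>T)"
    unfolding Q_def by (subst transpose_four_block_mat[of _ 1 1 _ ?m _ ?m]) (use P in auto)
  have QQ: "Q\<^sup>T * Q = 1\<^sub>m n"
  proof -
    have "Q\<^sup>T * Q = four_block_mat (1\<^sub>m 1) (0\<^sub>m 1 ?m) (0\<^sub>m ?m 1) (1\<^sub>m ?m)"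
      unfolding Qt unfolding Q_def
      by (subst mult_four_block_mat[of _ 1 1 _ ?m _ ?m _ _ 1 _ ?m]) (use P in auto)
    also have "\<dots> = 1\<^sub>m n" by (rule eq_matI) (use n in auto)
    finally show ?thesis .
  qed
  have QAQ: "Q\<^sup>T * A * Q = mat_diag n (\<lambda>i. (e # es) ! i)"
  proof -
    have "Q\<^sup>T * A * Q = four_block_mat ?E (0\<^sub>m 1 ?m) (0\<^sub>m ?m 1) (P\<^sup>T * A3 * P)"
      unfolding Qt Ablock unfolding Q_def
      apply (subst mult_four_block_mat[of _ 1 1 _ ?m _ ?m _ _ 1 _ ?m]) using P A3 apply auto[6]
      apply (subst mult_four_block_mat[of _ 1 1 _ ?m _ ?m _ _ 1 _ ?m]) using P A3 by auto
    also have "\<dots> = mat_diag n (\<lambda>i. (e # es) ! i)"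
      unfolding PD by (rule eq_matI) (use n in \<open>auto simp: mat_diag_def\<close>)
    finally show ?thesis .
  qed
  have WQ: "W * Q \<in> carrier_mat n n" using W Q by simp
  have t: "(W * Q)\<^sup>T = Q\<^sup>T * W\<^sup>T" by (rule transpose_mult[OF W Q])
  have "(W * Q)\<^sup>T * (W * Q) = Q\<^sup>T * (W\<^sup>T * W) * Q"
    unfolding t using W Q by (simp add: assoc_mult_mat[of _ n n _ n _ n])
  then have 1: "(W * Q)\<^sup>T * (W * Q) = 1\<^sub>m n" unfolding WW using Q QQ by simp
  have "(W * Q)\<^sup>T * S * (W * Q) = Q\<^sup>T * A * Q"
    unfolding t A_def using W Q S by (simp add: assoc_mult_mat[of _ n n _ n _ n])
  then show ?case using 1 WQ QAQ by auto
qed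

section \<open>Ordered eigenvalues and their min-max comparison\<close>

text \<open>The list indexed by \<open>singular_value\<close> when \<open>G\<close> is
  \<open>A\<^sup>T * A\<close>: decreasing, with multiplicity, here counted from 0.\<close>

definition eigs :: "real mat \<Rightarrow> real list" where
  "eigs G = rev (sorted_list_of_multiset (proots (char_poly G)))"

lemma eigs_unique:
  assumes "mset xs = proots (char_poly G)" "sorted (rev xs)"
  shows "eigs G = xs"
proof -
  have "sorted_list_of_multiset (proots (char_poly G)) = sort (rev xs)"
    by (metis assms(1) mset_rev sorted_list_of_multiset_mset)
  also have "\<dots> = rev xs" using assms(2) by (rule sorted_sort_id)
  finally show ?thesis unfolding eigs_def by simp
qed

lemma mset_eigs: "mset (eigs G) = proots (char_poly G)"
  unfolding eigs_def by simp

lemma eigs_antimono: "i \<le> j \<Longrightarrow> j < length (eigs G) \<Longrightarrow> eigs G ! j \<le> eigs G ! i"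
  unfolding eigs_def
  by (metis length_rev rev_rev_ident sorted_rev_nth_mono sorted_sorted_list_of_multiset)

text \<open>Symmetry makes the characteristic polynomial split over the reals, so
  \<open>proots\<close> loses no eigenvalue.\<close>

lemma symmetric_char_poly_eigs:
  assumes S: "S \<in> carrier_mat n n" "S\<^sup>T = S"
  shows "char_poly S = (\<Prod>e\<leftarrow>eigs S. [:- e, 1:])" "length (eigs S) = n"
proof -
  have "monic (char_poly S)" using degree_monic_char_poly[OF S(1)] by simp
  then obtain es where es: "char_poly S = (\<Prod>e\<leftarrow>es. [:- e, 1:])"
    using real_rooted_factorization[of "char_poly S"] symmetric_complex_eigenvalue_real[OF S] by blast
  have "proots (\<Prod>e\<leftarrow>es. [:- e, 1:]) = mset es" for es :: "real list"
  proof (induction es)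
    case (Cons e es)
    have "(\<Prod>e\<leftarrow>es. [:- e, 1:]) \<noteq> 0" by (auto simp: prod_list_zero_iff)
    then have "proots ([:- e, 1:] * (\<Prod>e\<leftarrow>es. [:- e, 1:])) = proots [:- e, 1:] + proots (\<Prod>e\<leftarrow>es. [:- e, 1:])"
      by (intro proots_mult) auto
    then show ?case using Cons by (simp del: mult_pCons_left)
  qed simp
  then have m: "mset (eigs S) = mset es" unfolding mset_eigs es by simp
  have "(\<Prod>e\<leftarrow>xs. [:- e, 1:]) = prod_mset (image_mset (\<lambda>e. [:- e, 1:]) (mset xs))" for xs :: "real list"
    by (simp add: prod_mset_prod_list flip: mset_map)
  then show c: "char_poly S = (\<Prod>e\<leftarrow>eigs S. [:- e, 1:])" unfolding es using m by metis
  show "length (eigs S) = n"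
    using degree_monic_char_poly[OF S(1)] degree_linear_factors[of uminus "eigs S"] unfolding c by simp
qed

lemma spectral_theorem:
  assumes S: "S \<in> carrier_mat n n" "S\<^sup>T = S"
  obtains P where "P \<in> carrier_mat n n" "P\<^sup>T * P = 1\<^sub>m n" "P * P\<^sup>T = 1\<^sub>m n"
    "S = P * mat_diag n (\<lambda>i. eigs S ! i) * P\<^sup>T"
proof -
  from spectral_theorem_list[OF S symmetric_char_poly_eigs(1)[OF S]]
  obtain P where P: "P \<in> carrier_mat n n" "P\<^sup>T * P = 1\<^sub>m n"
    and D: "P\<^sup>T * S * P = mat_diag n (\<lambda>i. eigs S ! i)" by blast
  have P': "P * P\<^sup>T = 1\<^sub>m n" using mat_mult_left_right_inverse[OF _ P(1) P(2)] P(1) by simp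
  have "P * (P\<^sup>T * S * P) * P\<^sup>T = (P * P\<^sup>T) * S * (P * P\<^sup>T)"
    using P(1) S by (simp add: assoc_mult_mat[of _ n n _ n _ n])
  then have "S = P * mat_diag n (\<lambda>i. eigs S ! i) * P\<^sup>T" unfolding D P' using S by simp
  then show ?thesis using that P P' by blast
qed

lemma scalar_prod_mult_mat_vec:
  fixes A :: "real mat"
  assumes "A \<in> carrier_mat n k" "x \<in> carrier_vec n" "y \<in> carrier_vec k"
  shows "x \<bullet> (A *\<^sub>v y) = (A\<^sup>T *\<^sub>v x) \<bullet> y"
  using assms by (metis transpose_vec_mult_scalar)

lemma isometry_scalar_prod:
  fixes E :: "real mat"
  assumes E: "E \<in> carrier_mat n k" "E\<^sup>T * E = 1\<^sub>m k" and x: "x \<in> carrier_vec k"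
  shows "(E *\<^sub>v x) \<bullet> (E *\<^sub>v x) = x \<bullet> x"
proof -
  have "(E *\<^sub>v x) \<bullet> (E *\<^sub>v x) = (E\<^sup>T *\<^sub>v (E *\<^sub>v x)) \<bullet> x"
    using E(1) x by (intro scalar_prod_mult_mat_vec) auto
  also have "E\<^sup>T *\<^sub>v (E *\<^sub>v x) = (E\<^sup>T * E) *\<^sub>v x" using E(1) x by simp
  finally show ?thesis using E(2) x by simp
qed

lemma mat_diag_mult_vec:
  fixes y :: "'a :: semiring_1 vec"
  assumes y: "y \<in> carrier_vec n"
  shows "mat_diag n d *\<^sub>v y = vec n (\<lambda>i. d i * y $ i)"
proof (rule eq_vecI)
  fix i assume "i < dim_vec (vec n (\<lambda>i. d i * y $ i))"
  then have i: "i < n" by simp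
  then have "(mat_diag n d *\<^sub>v y) $ i = (\<Sum>j<n. (if i = j then d j else 0) * y $ j)"
    using y unfolding mat_diag_def by (simp add: scalar_prod_def atLeast0LessThan)
  also have "\<dots> = d i * y $ i" using i by (simp add: if_distrib[of "\<lambda>c. c * _"] cong: if_cong)
  finally show "(mat_diag n d *\<^sub>v y) $ i = vec n (\<lambda>i. d i * y $ i) $ i" using i by simp
qed (simp add: mat_diag_def)

lemma quadratic_form_diag:
  assumes P: "P \<in> carrier_mat n n" and S: "S = P * mat_diag n d * P\<^sup>T" and x: "x \<in> carrier_vec n"
  shows "x \<bullet> (S *\<^sub>v x) = (\<Sum>i<n. d i * ((P\<^sup>T *\<^sub>v x) $ i :: real)\<^sup>2)"
proof -
  let ?y = "P\<^sup>T *\<^sub>v x"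
  have y: "?y \<in> carrier_vec n" using P x by simp
  have "S *\<^sub>v x = P *\<^sub>v (mat_diag n d *\<^sub>v ?y)"
    unfolding S using P x
      assoc_mult_mat_vec[of "P * mat_diag n d" n n "P\<^sup>T" n x] assoc_mult_mat_vec[of P n n "mat_diag n d" n "P\<^sup>T *\<^sub>v x"]
    by (metis mat_diag_dim mult_carrier_mat transpose_carrier_mat mult_mat_vec_carrier)
  then have "x \<bullet> (S *\<^sub>v x) = ?y \<bullet> (mat_diag n d *\<^sub>v ?y)"
    using scalar_prod_mult_mat_vec[OF P x, of "mat_diag n d *\<^sub>v ?y"] y by (simp add: mult_mat_vec_carrier[of _ n n])
  also have "mat_diag n d *\<^sub>v ?y = vec n (\<lambda>i. d i * ?y $ i)" by (rule mat_diag_mult_vec[OF y])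
  also have "?y \<bullet> vec n (\<lambda>i. d i * ?y $ i) = (\<Sum>i<n. d i * (?y $ i)\<^sup>2)"
    by (auto simp: scalar_prod_def atLeast0LessThan power2_eq_square intro!: sum.cong)
  finally show ?thesis .
qed

text \<open>The Courant-Fischer argument. On the span of the top \<open>k + 1\<close> eigenvectors
  of \<open>G\<close> its form is at least \<open>eigs G ! k\<close> times the squared norm;
  orthogonally to the top \<open>k\<close> eigenvectors of \<open>H\<close> its form is at most
  \<open>eigs H ! k\<close> times the squared norm. By dimension count some nonzero \<open>x\<close>
  in the former space has its image under the isometry \<open>E\<close> in the latter.\<close>

lemma eigs_le:
  assumes G: "G \<in> carrier_mat a a" "G\<^sup>T = G" and H: "H \<in> carrier_mat n n" "H\<^sup>T = H"
    and E: "E \<in> carrier_mat n a" "E\<^sup>T * E = 1\<^sub>m a"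
    and le: "\<And>x. x \<in> carrier_vec a \<Longrightarrow> x \<bullet> (G *\<^sub>v x) \<le> (E *\<^sub>v x) \<bullet> (H *\<^sub>v (E *\<^sub>v x))"
    and k: "k < a" "k < n"
  shows "eigs G ! k \<le> eigs H ! k"
proof -
  obtain P where P: "P \<in> carrier_mat a a" "P\<^sup>T * P = 1\<^sub>m a" and GP: "G = P * mat_diag a (\<lambda>i. eigs G ! i) * P\<^sup>T"
    using spectral_theorem[OF G] by metis
  obtain Q where Q: "Q \<in> carrier_mat n n" "Q * Q\<^sup>T = 1\<^sub>m n" and HQ: "H = Q * mat_diag n (\<lambda>i. eigs H ! i) * Q\<^sup>T"
    using spectral_theorem[OF H] by metis
  have lenG: "length (eigs G) = a" by (rule symmetric_char_poly_eigs(2)[OF G])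
  have lenH: "length (eigs H) = n" by (rule symmetric_char_poly_eigs(2)[OF H])
  define R where "R = Q\<^sup>T * E * P"
  have R: "R \<in> carrier_mat n a" using Q(1) E(1) P(1) unfolding R_def by simp
  \<comment> \<open>A combination of the top \<open>k + 1\<close> eigenvectors of \<open>G\<close> whose image is orthogonal to the top \<open>k\<close>
    eigenvectors of \<open>H\<close>: \<open>k\<close> equations, padded by a zero row to a singular square system.\<close>
  define K where "K = mat (Suc k) (Suc k) (\<lambda>(l,j). if l < k then R $$ (l,j) else 0)"
  have K: "K \<in> carrier_mat (Suc k) (Suc k)" unfolding K_def by simp
  have "det K = (\<Sum>j<Suc k. K $$ (k,j) * cofactor K k j)" by (rule laplace_expansion_row[OF K]) simp
  also have "\<dots> = 0" unfolding K_def by (intro sum.neutral) auto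
  finally obtain y where y: "y \<in> carrier_vec (Suc k)" "y \<noteq> 0\<^sub>v (Suc k)" and Ky: "K *\<^sub>v y = 0\<^sub>v (Suc k)"
    using det_0_iff_vec_prod_zero[OF K] by blast
  \<comment> \<open>\<open>y'\<close> holds the coordinates of \<open>x\<close> in the eigenbasis of
    \<open>G\<close>, and \<open>z\<close> below those of \<open>E *\<^sub>v x\<close> in the
    eigenbasis of \<open>H\<close>.\<close>
  define y' where "y' = vec a (\<lambda>j. if j \<le> k then y $ j else 0)"
  have y': "y' \<in> carrier_vec a" unfolding y'_def by simp
  define x where "x = P *\<^sub>v y'"
  have x: "x \<in> carrier_vec a" unfolding x_def using P(1) y' by simp
  have "P\<^sup>T *\<^sub>v x = (P\<^sup>T * P) *\<^sub>v y'" unfolding x_def using P(1) y' by simp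
  then have Px: "P\<^sup>T *\<^sub>v x = y'" using P(2) y' by simp
  define z where "z = Q\<^sup>T *\<^sub>v (E *\<^sub>v x)"
  have z: "z \<in> carrier_vec n" unfolding z_def using Q(1) E(1) x by simp
  have zR: "z = R *\<^sub>v y'" unfolding z_def R_def x_def using Q(1) E(1) P(1) y'
    by (simp add: assoc_mult_mat_vec[of _ n a _ a] assoc_mult_mat_vec[of _ n n _ a])
  have z0: "z $ l = 0" if l: "l < k" for l
  proof -
    have ln: "l < n" using l k by simp
    have "z $ l = (\<Sum>j<a. R $$ (l,j) * y' $ j)"
      unfolding zR using R y' ln by (simp add: scalar_prod_def atLeast0LessThan)
    also have "\<dots> = (\<Sum>j<Suc k. R $$ (l,j) * y $ j)"
      using k(1) by (intro sum.mono_neutral_cong_right) (auto simp: y'_def)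
    also have "\<dots> = (K *\<^sub>v y) $ l"
      using l y(1) K by (simp add: scalar_prod_def atLeast0LessThan K_def)
    finally show ?thesis using Ky l by simp
  qed
  have zz: "z \<bullet> z = y' \<bullet> y'"
  proof -
    have "z \<bullet> z = (E *\<^sub>v x) \<bullet> (E *\<^sub>v x)"
      unfolding z_def using Q E(1) x by (intro isometry_scalar_prod[of _ n n]) auto
    also have "\<dots> = x \<bullet> x" by (rule isometry_scalar_prod[OF E x])
    also have "\<dots> = y' \<bullet> y'" unfolding x_def by (rule isometry_scalar_prod[OF P y'])
    finally show ?thesis .
  qed
  have pos: "y' \<bullet> y' > 0"
  proof -
    have "y' \<noteq> 0\<^sub>v a"
    proof
      assume 0: "y' = 0\<^sub>v a"
      have "y $ j = 0" if "j < Suc k" for j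
        using arg_cong[OF 0, of "\<lambda>v. v $ j"] that k(1) unfolding y'_def by simp
      then have "y = 0\<^sub>v (Suc k)" using y(1) by (intro eq_vecI) auto
      then show False using y(2) by simp
    qed
    then show ?thesis using scalar_prod_self_eq_0[OF y'] scalar_prod_self_nonneg[of y'] by linarith
  qed
  \<comment> \<open>The coordinates at which \<open>y'\<close> and \<open>z\<close> vanish are those
    whose eigenvalue would compare the wrong way with the one at index \<open>k\<close>.\<close>
  have "eigs G ! k * (y' \<bullet> y') = (\<Sum>i<a. eigs G ! k * (y' $ i)\<^sup>2)"
    using y' by (simp add: scalar_prod_self_sum sum_distrib_left)
  also have "\<dots> \<le> (\<Sum>i<a. eigs G ! i * (y' $ i)\<^sup>2)"
  proof (intro sum_mono)
    fix i assume "i \<in> {..<a}"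
    then show "eigs G ! k * (y' $ i)\<^sup>2 \<le> eigs G ! i * (y' $ i)\<^sup>2"
      using eigs_antimono[of i k G] k(1) lenG
      by (cases "i \<le> k") (auto simp: y'_def intro!: mult_right_mono)
  qed
  also have "\<dots> = x \<bullet> (G *\<^sub>v x)" using quadratic_form_diag[OF P(1) GP x] Px by simp
  also have "\<dots> \<le> (E *\<^sub>v x) \<bullet> (H *\<^sub>v (E *\<^sub>v x))" by (rule le[OF x])
  also have "\<dots> = (\<Sum>i<n. eigs H ! i * (z $ i)\<^sup>2)"
    unfolding z_def using quadratic_form_diag[OF Q(1) HQ, of "E *\<^sub>v x"] E(1) x by simp
  also have "\<dots> \<le> (\<Sum>i<n. eigs H ! k * (z $ i)\<^sup>2)"
  proof (intro sum_mono)
    fix i assume "i \<in> {..<n}"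
    then show "eigs H ! i * (z $ i)\<^sup>2 \<le> eigs H ! k * (z $ i)\<^sup>2"
      using eigs_antimono[of k i H] z0[of i] lenH
      by (cases "i < k") (auto intro!: mult_right_mono)
  qed
  also have "\<dots> = eigs H ! k * (y' \<bullet> y')"
    unfolding zz[symmetric] using z by (simp add: scalar_prod_self_sum sum_distrib_left)
  finally show ?thesis using pos by simp
qed

lemma det_mat_diag: "det (mat_diag n d :: real mat) = (\<Prod>i<n. d i)"
proof -
  have "det (mat_diag n d) = prod_list (diag_mat (mat_diag n d))"
    by (rule det_upper_triangular[of _ n]) (auto simp: mat_diag_def)
  also have "diag_mat (mat_diag n d) = map d [0..<n]"
    unfolding diag_mat_def by (simp add: mat_diag_def)
  finally show ?thesis by (simp add: prod.list_conv_set_nth atLeast0LessThan)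
qed

lemma det_eq_prod_eigs:
  assumes S: "S \<in> carrier_mat n n" "S\<^sup>T = S"
  shows "det S = (\<Prod>i<n. eigs S ! i)"
proof -
  obtain P where P: "P \<in> carrier_mat n n" "P\<^sup>T * P = 1\<^sub>m n" and SP: "S = P * mat_diag n (\<lambda>i. eigs S ! i) * P\<^sup>T"
    using spectral_theorem[OF S] by metis
  have "det S = det P * det (mat_diag n (\<lambda>i. eigs S ! i)) * det (P\<^sup>T)"
    by (subst SP) (use P(1) in \<open>simp add: det_mult[of _ n]\<close>)
  also have "\<dots> = det (P\<^sup>T * P) * det (mat_diag n (\<lambda>i. eigs S ! i))"
    using P(1) by (simp add: det_mult[of _ n])
  finally show ?thesis using P(2) by (simp add: det_mat_diag)
qed

section \<open>Gram matrices and their determinants\<close>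

lemma gram_symmetric:
  fixes A :: "real mat"
  shows "(A * A\<^sup>T)\<^sup>T = A * A\<^sup>T"
  by (subst transpose_mult[of _ "dim_row A" "dim_col A"]) auto

lemma gram_quadratic_form:
  fixes A :: "real mat"
  assumes "A \<in> carrier_mat n k" "x \<in> carrier_vec n"
  shows "x \<bullet> (A * A\<^sup>T *\<^sub>v x) = (A\<^sup>T *\<^sub>v x) \<bullet> (A\<^sup>T *\<^sub>v x)"
  using assms scalar_prod_mult_mat_vec[of A n k x "A\<^sup>T *\<^sub>v x"] by simp

text \<open>Each eigenvalue is the value of the quadratic form at a unit eigenvector
  \<open>P *\<^sub>v unit_vec n i\<close>, hence a squared norm.\<close>

lemma gram_eigs_nonneg:
  fixes A :: "real mat"
  assumes A: "A \<in> carrier_mat n k" and i: "i < n"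
  shows "eigs (A * A\<^sup>T) ! i \<ge> 0"
proof -
  have S: "A * A\<^sup>T \<in> carrier_mat n n" using A by simp
  obtain P where P: "P \<in> carrier_mat n n" "P\<^sup>T * P = 1\<^sub>m n"
      and SP: "A * A\<^sup>T = P * mat_diag n (\<lambda>i. eigs (A * A\<^sup>T) ! i) * P\<^sup>T"
    using spectral_theorem[OF S gram_symmetric] by metis
  let ?x = "P *\<^sub>v unit_vec n i"
  have x: "?x \<in> carrier_vec n" using P(1) by simp
  have "P\<^sup>T *\<^sub>v ?x = (P\<^sup>T * P) *\<^sub>v unit_vec n i" using P(1) by simp
  then have Px: "P\<^sup>T *\<^sub>v ?x = unit_vec n i" using P(2) by simp
  have "(\<Sum>j<n. eigs (A * A\<^sup>T) ! j * (unit_vec n i $ j :: real)\<^sup>2) = eigs (A * A\<^sup>T) ! i"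
    using i by (simp add: unit_vec_def if_distrib[of "\<lambda>c. _ * c"] if_distrib[of "\<lambda>c. c ^ 2"] cong: if_cong)
  then have "?x \<bullet> (A * A\<^sup>T *\<^sub>v ?x) = eigs (A * A\<^sup>T) ! i"
    using quadratic_form_diag[OF P(1) SP x] unfolding Px by simp
  then show ?thesis using gram_quadratic_form[OF A x] scalar_prod_self_nonneg by metis
qed

lemma gram_det_nonneg:
  fixes A :: "real mat"
  assumes A: "A \<in> carrier_mat n k"
  shows "det (A * A\<^sup>T) \<ge> 0"
proof -
  have S: "A * A\<^sup>T \<in> carrier_mat n n" using A by simp
  show ?thesis unfolding det_eq_prod_eigs[OF S gram_symmetric]
    by (intro prod_nonneg) (auto intro: gram_eigs_nonneg[OF A])
qed

text \<open>The form of \<open>A * A\<^sup>T\<close> at \<open>x\<close> is the squared norm of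
  \<open>A\<^sup>T *\<^sub>v x\<close>, so both matrices have the same kernel. A zero Gram
  determinant thus means dependent rows.\<close>

lemma gram_det_eq_0_iff:
  fixes A :: "real mat"
  assumes A: "A \<in> carrier_mat n k"
  shows "det (A * A\<^sup>T) = 0 \<longleftrightarrow> (\<exists>x. x \<in> carrier_vec n \<and> x \<noteq> 0\<^sub>v n \<and> A\<^sup>T *\<^sub>v x = 0\<^sub>v k)"
proof -
  have S: "A * A\<^sup>T \<in> carrier_mat n n" using A by simp
  have "A * A\<^sup>T *\<^sub>v x = 0\<^sub>v n \<longleftrightarrow> A\<^sup>T *\<^sub>v x = 0\<^sub>v k" if x: "x \<in> carrier_vec n" for x
  proof
    assume "A * A\<^sup>T *\<^sub>v x = 0\<^sub>v n"
    then have "(A\<^sup>T *\<^sub>v x) \<bullet> (A\<^sup>T *\<^sub>v x) = 0" using gram_quadratic_form[OF A x] x by simp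
    then show "A\<^sup>T *\<^sub>v x = 0\<^sub>v k" using scalar_prod_self_eq_0[of "A\<^sup>T *\<^sub>v x" k] A x by simp
  next
    assume "A\<^sup>T *\<^sub>v x = 0\<^sub>v k"
    then show "A * A\<^sup>T *\<^sub>v x = 0\<^sub>v n" using A x
      by (simp add: assoc_mult_mat_vec[of _ n k _ n]) (auto intro!: eq_vecI)
  qed
  then show ?thesis unfolding det_0_iff_vec_prod_zero[OF S] by blast
qed

subsection \<open>Singular values\<close>

text \<open>Both sides are the determinant of \<open>[[x I, A], [B, I]]\<close> times \<open>x ^ k\<close>.\<close>

lemma sylvester_det:
  fixes A B :: "'a :: idom mat"
  assumes A: "A \<in> carrier_mat n k" and B: "B \<in> carrier_mat k n"
  shows "x ^ k * det (x \<cdot>\<^sub>m 1\<^sub>m n - A * B) = x ^ n * det (x \<cdot>\<^sub>m 1\<^sub>m k - B * A)"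
proof -
  let ?K = "four_block_mat (x \<cdot>\<^sub>m 1\<^sub>m n) A B (1\<^sub>m k)"
  let ?L = "four_block_mat (1\<^sub>m n) (0\<^sub>m n k) (- B) (1\<^sub>m k)"
  let ?U = "four_block_mat (1\<^sub>m n) (- A) (0\<^sub>m k n) (x \<cdot>\<^sub>m 1\<^sub>m k)"
  have K: "?K \<in> carrier_mat (n + k) (n + k)" by (rule four_block_carrier_mat) auto
  have L: "?L \<in> carrier_mat (n + k) (n + k)" by (rule four_block_carrier_mat) auto
  have U: "?U \<in> carrier_mat (n + k) (n + k)" by (rule four_block_carrier_mat) auto
  have "?K * ?L = four_block_mat (x \<cdot>\<^sub>m 1\<^sub>m n - A * B) A (0\<^sub>m k n) (1\<^sub>m k)"
    apply (subst mult_four_block_mat[of _ n n _ k _ k _ _ n _ k])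
    using A B by (auto simp: minus_add_uminus_mat[of _ n n] intro!: arg_cong4[of _ _ _ _ _ _ _ _ four_block_mat])
  moreover have "det (four_block_mat (x \<cdot>\<^sub>m 1\<^sub>m n - A * B) A (0\<^sub>m k n) (1\<^sub>m k)) = det (x \<cdot>\<^sub>m 1\<^sub>m n - A * B)"
    using A B by (subst det_four_block_mat_lower_left_zero[of _ n _ k]) auto
  moreover have "det ?L = 1" using B by (subst det_four_block_mat_upper_right_zero[of _ n _ k]) auto
  ultimately have 1: "det ?K = det (x \<cdot>\<^sub>m 1\<^sub>m n - A * B)" using det_mult[OF K L] by simp
  have "?K * ?U = four_block_mat (x \<cdot>\<^sub>m 1\<^sub>m n) (0\<^sub>m n k) B (x \<cdot>\<^sub>m 1\<^sub>m k - B * A)"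
    apply (subst mult_four_block_mat[of _ n n _ k _ k _ _ n _ k])
    using A B mult_smult_distrib[OF A one_carrier_mat, of x] mult_smult_assoc_mat[OF one_carrier_mat, of "- A" n k x]
    by (auto simp: add_uminus_minus_mat)
  moreover have "det (four_block_mat (x \<cdot>\<^sub>m 1\<^sub>m n) (0\<^sub>m n k) B (x \<cdot>\<^sub>m 1\<^sub>m k - B * A)) = x ^ n * det (x \<cdot>\<^sub>m 1\<^sub>m k - B * A)"
    using A B by (subst det_four_block_mat_upper_right_zero[of _ n _ k]) (auto simp: det_smult)
  moreover have "det ?U = x ^ k" using A by (subst det_four_block_mat_lower_left_zero[of _ n _ k]) (auto simp: det_smult)
  ultimately have "det ?K * x ^ k = x ^ n * det (x \<cdot>\<^sub>m 1\<^sub>m k - B * A)" using det_mult[OF K U] by simp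
  then show ?thesis unfolding 1 by (simp add: mult.commute)
qed

lemma pCons_0_sum: "[:sum f A:] = (\<Sum>i\<in>A. [:f i:])"
  by (induction A rule: infinite_finite_induct) (auto simp del: add_pCons simp: add_pCons[of _ 0 _ 0, simplified, symmetric])

lemma char_poly_eq_det_minus:
  assumes "A \<in> carrier_mat n n"
  shows "char_poly A = det ([:0, 1:] \<cdot>\<^sub>m 1\<^sub>m n - map_mat (\<lambda>a. [:a:]) (A :: 'a :: comm_ring_1 mat))"
  unfolding char_poly_defs by (rule arg_cong[of _ _ det]) (use assms in \<open>auto intro!: eq_matI\<close>)

text \<open>This is \<open>sylvester_det\<close> over the polynomial ring with the indeterminate for
  \<open>x\<close>; \<open>hom\<close> says that embedding the entries as constants respects
  products.\<close>

lemma char_poly_mult_commute: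
  fixes A B :: "'a :: idom mat"
  assumes A: "A \<in> carrier_mat n k" and B: "B \<in> carrier_mat k n"
  shows "[:0, 1:] ^ k * char_poly (A * B) = [:0, 1:] ^ n * char_poly (B * A)"
proof -
  have hom: "map_mat (\<lambda>a. [:a:]) (X * Y) = map_mat (\<lambda>a. [:a:]) X * map_mat (\<lambda>a. [:a:]) Y"
    if "X \<in> carrier_mat l m" "Y \<in> carrier_mat m l" for X Y :: "'a mat" and l m
    using that by (intro eq_matI) (auto simp: scalar_prod_def pCons_0_sum mult.commute)
  show ?thesis
    using sylvester_det[of "map_mat (\<lambda>a. [:a:]) A" n k "map_mat (\<lambda>a. [:a:]) B" "[:0, 1:]"] A B
    by (simp add: char_poly_eq_det_minus[of _ n] char_poly_eq_det_minus[of _ k] hom[OF A B] hom[OF B A])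
qed

lemma rev_replicate_append_sorted:
  assumes "sorted (rev xs)" "\<And>x. x \<in> set xs \<Longrightarrow> 0 \<le> (x :: real)"
  shows "sorted (rev (xs @ replicate d 0))"
  using assms by (auto simp: sorted_append)

text \<open>The two characteristic polynomials differ by a power of the indeterminate, that is, by
  \<open>k - n\<close> zero roots. Since Gram eigenvalues are nonnegative, these zeros belong at the
  end of the decreasing list.\<close>

lemma eigs_gram_append:
  fixes A :: "real mat"
  assumes A: "A \<in> carrier_mat n k" and le: "n \<le> k"
  shows "eigs (A\<^sup>T * A) = eigs (A * A\<^sup>T) @ replicate (k - n) 0"
proof (rule eigs_unique)
  have S: "A * A\<^sup>T \<in> carrier_mat n n" using A by simp
  have T: "A\<^sup>T * A \<in> carrier_mat k k" using A by simp
  have nz: "char_poly (A * A\<^sup>T) \<noteq> 0" "char_poly (A\<^sup>T * A) \<noteq> 0"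
    using degree_monic_char_poly[OF S] degree_monic_char_poly[OF T] by auto
  have x: "proots ([:0, 1:] ^ j :: real poly) = replicate_mset j 0" for j
    by (simp add: proots_power multiset_eq_iff)
  have "proots ([:0, 1:] ^ k * char_poly (A * A\<^sup>T)) = proots ([:0, 1:] ^ n * char_poly (A\<^sup>T * A))"
    using char_poly_mult_commute[of A n k "A\<^sup>T"] A by simp
  then have eq: "replicate_mset k 0 + proots (char_poly (A * A\<^sup>T)) = replicate_mset n 0 + proots (char_poly (A\<^sup>T * A))"
    using nz by (simp add: proots_mult x)
  have "replicate_mset k (0::real) = replicate_mset n 0 + replicate_mset (k - n) 0"
    using le by (simp add: multiset_eq_iff)
  then have "proots (char_poly (A\<^sup>T * A)) = proots (char_poly (A * A\<^sup>T)) + replicate_mset (k - n) 0"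
    using eq by (simp add: ac_simps)
  then show "mset (eigs (A * A\<^sup>T) @ replicate (k - n) 0) = proots (char_poly (A\<^sup>T * A))"
    by (simp add: mset_eigs)
  have len: "length (eigs (A * A\<^sup>T)) = n" by (rule symmetric_char_poly_eigs(2)[OF S gram_symmetric])
  show "sorted (rev (eigs (A * A\<^sup>T) @ replicate (k - n) 0))"
  proof (rule rev_replicate_append_sorted)
    show "sorted (rev (eigs (A * A\<^sup>T)))" unfolding eigs_def by simp
    show "0 \<le> x" if "x \<in> set (eigs (A * A\<^sup>T))" for x
      using that gram_eigs_nonneg[OF A] len by (auto simp: in_set_conv_nth)
  qed
qed

lemma eigs_gram_transpose:
  fixes A :: "real mat"
  assumes A: "A \<in> carrier_mat n k" and i: "i < n" "i < k"
  shows "eigs (A\<^sup>T * A) ! i = eigs (A * A\<^sup>T) ! i"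
proof (cases "n \<le> k")
  case True
  have "length (eigs (A * A\<^sup>T)) = n"
    using A by (intro symmetric_char_poly_eigs(2) gram_symmetric) auto
  then show ?thesis using eigs_gram_append[OF A True] i by (simp add: nth_append)
next
  case False
  have "length (eigs (A\<^sup>T * A)) = k"
    using symmetric_char_poly_eigs(2)[of "A\<^sup>T * A" k] gram_symmetric[of "A\<^sup>T"] A by simp
  then show ?thesis using eigs_gram_append[of "A\<^sup>T" k n] False A i by (simp add: nth_append)
qed

text \<open>Allows the rest of the proof to work with \<open>A * A\<^sup>T\<close>, whose size is
  the number of rows, although \<open>singular_value\<close> is defined through
  \<open>A\<^sup>T * A\<close>. The \<open>Suc\<close> translates between counting from 0 and from
  1.\<close>

lemma singular_value_eq:
  assumes A: "A \<in> carrier_mat n k" and i: "i < n" "i < k"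
  shows "singular_value A (Suc i) = sqrt (eigs (A * A\<^sup>T) ! i)"
  using eigs_gram_transpose[OF A i] unfolding singular_value_def eigs_def by simp

text \<open>Turns maximality of the volume into maximality of a Gram determinant;
  \<open>n \<le> k\<close> keeps all \<open>n\<close> factors in the range of
  \<open>singular_value_eq\<close>.\<close>

lemma volume_eq_sqrt_gram_det:
  assumes A: "A \<in> carrier_mat n k" and le: "n \<le> k"
  shows "volume n A = sqrt (det (A * A\<^sup>T))"
proof -
  have S: "A * A\<^sup>T \<in> carrier_mat n n" using A by simp
  have p: "sqrt (\<Prod>i<j. f i) = (\<Prod>i<j. sqrt (f i))" for f :: "nat \<Rightarrow> real" and j
    by (induction j) (simp_all add: real_sqrt_mult)
  have "volume n A = (\<Prod>i<n. singular_value A (Suc i))"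
    unfolding volume_def by (simp add: prod.atLeast1_atMost_eq)
  also have "\<dots> = (\<Prod>i<n. sqrt (eigs (A * A\<^sup>T) ! i))"
    using le by (intro prod.cong) (auto intro!: singular_value_eq[OF A])
  finally show ?thesis unfolding det_eq_prod_eigs[OF S gram_symmetric] p .
qed

subsection \<open>Submatrices and Gram determinants\<close>

text \<open>Rows and columns are picked by index maps rather than index sets, so that appending one
  is a function update and deleting one a composition with \<open>insert_index\<close>. Injectivity
  is imposed where a genuine submatrix is meant.\<close>

definition select_mat :: "'a mat \<Rightarrow> nat \<Rightarrow> nat \<Rightarrow> (nat \<Rightarrow> nat) \<Rightarrow> (nat \<Rightarrow> nat) \<Rightarrow> 'a mat" where
  "select_mat M a c f g = mat a c (\<lambda>(i, j). M $$ (f i, g j))"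

lemma select_mat_carrier [simp]: "select_mat M a c f g \<in> carrier_mat a c"
  by (simp add: select_mat_def)

lemma select_mat_dim [simp]: "dim_row (select_mat M a c f g) = a" "dim_col (select_mat M a c f g) = c"
  by (simp_all add: select_mat_def)

lemma select_mat_index [simp]: "i < a \<Longrightarrow> j < c \<Longrightarrow> select_mat M a c f g $$ (i, j) = M $$ (f i, g j)"
  by (simp add: select_mat_def)

text \<open>The coordinate embedding \<open>E\<close> along \<open>f\<close> is an isometry, and
  \<open>?D\<^sup>T *\<^sub>v x\<close> consists of the coordinates of
  \<open>M\<^sup>T *\<^sub>v (E *\<^sub>v x)\<close> chosen by \<open>g\<close>, so its squared norm
  can only be smaller. Then \<open>eigs_le\<close> applies.\<close>

lemma eigs_gram_select_mat_le:
  fixes M :: "real mat"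
  assumes M: "M \<in> carrier_mat m n"
    and f: "inj_on f {..<a}" "f ` {..<a} \<subseteq> {..<m}"
    and g: "inj_on g {..<c}" "g ` {..<c} \<subseteq> {..<n}"
    and k: "k < a"
  shows "eigs (select_mat M a c f g * (select_mat M a c f g)\<^sup>T) ! k \<le> eigs (M * M\<^sup>T) ! k"
proof -
  let ?D = "select_mat M a c f g"
  define E where "E = mat m a (\<lambda>(l, i). if l = f i then 1 else 0 :: real)"
  have E: "E \<in> carrier_mat m a" unfolding E_def by simp
  have am: "a \<le> m" using card_mono[OF _ f(2)] card_image[OF f(1)] by simp
  have fm: "f i < m" if "i < a" for i using f(2) that by auto
  have EE: "E\<^sup>T * E = 1\<^sub>m a"
  proof (rule eq_matI)
    fix i j assume "i < dim_row (1\<^sub>m a :: real mat)" "j < dim_col (1\<^sub>m a :: real mat)"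
    then have ij: "i < a" "j < a" by auto
    have "(E\<^sup>T * E) $$ (i, j) = (\<Sum>l<m. (if l = f i then 1 else 0) * (if l = f j then 1 else 0))"
      using ij unfolding E_def by (simp add: scalar_prod_def atLeast0LessThan)
    also have "\<dots> = (if f i = f j then 1 else 0)"
      using fm[OF ij(1)] by (simp add: if_distrib[of "\<lambda>c. c * _"] cong: if_cong)
    also have "\<dots> = 1\<^sub>m a $$ (i, j)" using inj_onD[OF f(1), of i j] ij by auto
    finally show "(E\<^sup>T * E) $$ (i, j) = 1\<^sub>m a $$ (i, j)" .
  qed (use E in auto)
  have ME: "M\<^sup>T * E = mat n a (\<lambda>(l, i). M $$ (f i, l))"
  proof (rule eq_matI)
    fix l i assume "l < dim_row (mat n a (\<lambda>(l, i). M $$ (f i, l)))" "i < dim_col (mat n a (\<lambda>(l, i). M $$ (f i, l)))"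
    then have li: "l < n" "i < a" by auto
    have "(M\<^sup>T * E) $$ (l, i) = (\<Sum>h<m. M $$ (h, l) * (if h = f i then 1 else 0))"
      using li M unfolding E_def by (simp add: scalar_prod_def atLeast0LessThan)
    also have "\<dots> = M $$ (f i, l)" using fm[OF li(2)] by (simp add: if_distrib[of "\<lambda>c. _ * c"] cong: if_cong)
    finally show "(M\<^sup>T * E) $$ (l, i) = mat n a (\<lambda>(l, i). M $$ (f i, l)) $$ (l, i)" using li by simp
  qed (use E M in auto)
  have le: "x \<bullet> (?D * ?D\<^sup>T *\<^sub>v x) \<le> (E *\<^sub>v x) \<bullet> (M * M\<^sup>T *\<^sub>v (E *\<^sub>v x))" if x: "x \<in> carrier_vec a" for x
  proof -
    let ?w = "M\<^sup>T *\<^sub>v (E *\<^sub>v x)"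
    have w: "?w \<in> carrier_vec n" using M E x by (simp add: mult_mat_vec_carrier[of _ n m])
    have "?w = M\<^sup>T * E *\<^sub>v x" using M E x by simp
    then have wl: "?w $ l = (\<Sum>i<a. M $$ (f i, l) * x $ i)" if "l < n" for l
      unfolding ME using that x by (simp add: scalar_prod_def atLeast0LessThan)
    have D: "(?D\<^sup>T *\<^sub>v x) $ j = ?w $ g j" if j: "j < c" for j
    proof -
      have "g j < n" using j g(2) by auto
      then show ?thesis using j x by (simp add: wl scalar_prod_def atLeast0LessThan del: index_mult_mat_vec[of _ "M\<^sup>T"])
    qed
    have "x \<bullet> (?D * ?D\<^sup>T *\<^sub>v x) = (\<Sum>j<c. (?w $ g j)\<^sup>2)"
      unfolding gram_quadratic_form[OF select_mat_carrier x] scalar_prod_self_sum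
      by (intro sum.cong) (auto simp: D simp del: index_mult_mat_vec)
    also have "\<dots> = (\<Sum>l\<in>g ` {..<c}. (?w $ l)\<^sup>2)"
      by (simp add: sum.reindex[OF g(1)])
    also have "\<dots> \<le> (\<Sum>l<n. (?w $ l)\<^sup>2)" by (rule sum_mono2) (use g(2) in auto)
    also have "\<dots> = ?w \<bullet> ?w" unfolding scalar_prod_self_sum carrier_vecD[OF w] ..
    also have "\<dots> = (E *\<^sub>v x) \<bullet> (M * M\<^sup>T *\<^sub>v (E *\<^sub>v x))"
      using gram_quadratic_form[OF M, of "E *\<^sub>v x"] E x by simp
    finally show ?thesis .
  qed
  show ?thesis
    by (rule eigs_le[OF _ gram_symmetric _ gram_symmetric E EE le])
      (use M k am in \<open>auto intro!: mult_carrier_mat\<close>)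
qed

section \<open>Principal minors and reciprocal eigenvalues\<close>

text \<open>The logarithmic derivative of a product of linear factors, evaluated at 0.\<close>

lemma pderiv_linear_factors_at_0:
  assumes "\<And>e. e \<in> set es \<Longrightarrow> e \<noteq> (0 :: real)"
  shows "poly (pderiv (\<Prod>e\<leftarrow>es. [:- e, 1:])) 0 = - poly (\<Prod>e\<leftarrow>es. [:- e, 1:]) 0 * (\<Sum>e\<leftarrow>es. 1 / e)"
  using assms
proof (induction es)
  case (Cons e es)
  then show ?case
    by (simp add: pderiv_mult pderiv_pCons field_simps del: mult_pCons_left)
qed simp

lemma char_poly_at_0:
  fixes S :: "real mat"
  assumes S: "S \<in> carrier_mat n n" "S\<^sup>T = S"
  shows "poly (char_poly S) 0 = (-1) ^ n * det S"
proof -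
  have *: "poly (\<Prod>e\<leftarrow>es. [:- e, 1:]) 0 = (-1) ^ length es * (\<Prod>i<length es. es ! i)" for es :: "real list"
    by (induction es) (simp_all del: mult_pCons_left prod.lessThan_Suc add: prod.lessThan_Suc_shift)
  show ?thesis
    using *[of "eigs S"] unfolding symmetric_char_poly_eigs(1)[OF S, symmetric] det_eq_prod_eigs[OF S] symmetric_char_poly_eigs(2)[OF S] .
qed

text \<open>Both sides are, up to the sign \<open>(-1) ^ r\<close>, the derivative of the
  characteristic polynomial at 0: once as the sum of the characteristic polynomials of the principal
  submatrices, once through the factorisation over \<open>eigs S\<close>.\<close>

lemma sum_principal_minors:
  fixes S :: "real mat"
  assumes S: "S \<in> carrier_mat (Suc r) (Suc r)" "S\<^sup>T = S" and det: "det S \<noteq> 0"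
  shows "(\<Sum>i<Suc r. det (mat_delete S i i)) = det S * (\<Sum>k<Suc r. 1 / eigs S ! k)"
proof -
  let ?N = "Suc r"
  have len: "length (eigs S) = ?N" by (rule symmetric_char_poly_eigs(2)[OF S])
  have nz: "e \<noteq> 0" if "e \<in> set (eigs S)" for e
    using that det len unfolding det_eq_prod_eigs[OF S]
    by (auto simp: in_set_conv_nth prod_zero_iff simp del: prod.lessThan_Suc)
  have md: "mat_delete S i i \<in> carrier_mat r r" "(mat_delete S i i)\<^sup>T = mat_delete S i i" if i: "i < ?N" for i
  proof -
    show "mat_delete S i i \<in> carrier_mat r r" using mat_delete_carrier[OF S(1)] by simp
    have "S $$ (a, b) = S $$ (b, a)" if "a < ?N" "b < ?N" for a b
      using S that by (metis index_transpose_mat(1) carrier_matD)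
    then show "(mat_delete S i i)\<^sup>T = mat_delete S i i"
      using S(1) i by (intro eq_matI) (auto simp: mat_delete_def)
  qed
  have "(-1) ^ r * (\<Sum>i<?N. det (mat_delete S i i)) = (\<Sum>i<?N. poly (char_poly (mat_delete S i i)) 0)"
    unfolding sum_distrib_left by (intro sum.cong refl) (simp add: char_poly_at_0[OF md])
  also have "\<dots> = poly (pderiv (char_poly S)) 0"
    unfolding pderiv_char_poly[OF S(1)] by (simp add: poly_sum)
  also have "\<dots> = - poly (char_poly S) 0 * (\<Sum>e\<leftarrow>eigs S. 1 / e)"
    using pderiv_linear_factors_at_0[of "eigs S"] nz unfolding symmetric_char_poly_eigs(1)[OF S, symmetric] by simp
  also have "\<dots> = (-1) ^ r * (det S * (\<Sum>e\<leftarrow>eigs S. 1 / e))"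
    by (simp add: char_poly_at_0[OF S])
  finally have "(\<Sum>i<?N. det (mat_delete S i i)) = det S * (\<Sum>e\<leftarrow>eigs S. 1 / e)" by simp
  also have "(\<Sum>e\<leftarrow>eigs S. 1 / e) = (\<Sum>k<?N. 1 / eigs S ! k)"
    using len by (simp add: sum_list_sum_nth atLeast0LessThan del: sum.lessThan_Suc)
  finally show ?thesis .
qed

section \<open>Gram determinants under deletion and bordering\<close>

text \<open>The matrix determinant lemma. Factoring out \<open>G\<close> leaves the identity minus a
  column times a row, and \<open>sylvester_det\<close> at 1 reduces this to a 1 by 1 determinant;
  the sign is put into \<open>U\<close> to reach that form.\<close>

lemma det_rank_one_update:
  fixes G H :: "'a :: field mat"
  assumes G: "G \<in> carrier_mat n n" and H: "H \<in> carrier_mat n n" "G * H = 1\<^sub>m n" and u: "u \<in> carrier_vec n"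
  shows "det (G + mat n n (\<lambda>(a, b). s * u $ a * u $ b)) = det G * (1 + s * (u \<bullet> (H *\<^sub>v u)))"
proof -
  have one_smult: "1 \<cdot>\<^sub>m 1\<^sub>m k = (1\<^sub>m k :: 'a mat)" for k by auto
  define U where "U = mat n 1 (\<lambda>(a, _). - s * u $ a)"
  define V where "V = mat 1 n (\<lambda>(_, b). u $ b)"
  have U: "U \<in> carrier_mat n 1" and V: "V \<in> carrier_mat 1 n" unfolding U_def V_def by auto
  have UV: "mat n n (\<lambda>(a, b). s * u $ a * u $ b) = - (U * V)"
    by (rule eq_matI) (auto simp: U_def V_def scalar_prod_def)
  have "G * (1\<^sub>m n - (H * U) * V) = G - G * ((H * U) * V)"
    using G H U V by (simp add: mult_minus_distrib_mat[of _ n n _ n])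
  also have "G * ((H * U) * V) = (G * H) * U * V"
    using G H(1) U V by (simp add: assoc_mult_mat[of _ n n _ _ _ n] assoc_mult_mat[of _ n n _ 1 _ n] assoc_mult_mat[of _ n n _ n _ 1])
  also have "\<dots> = U * V" using H U by simp
  finally have "G + mat n n (\<lambda>(a, b). s * u $ a * u $ b) = G * (1\<^sub>m n - (H * U) * V)"
    unfolding UV using G U V by (auto simp: minus_add_uminus_mat[of _ n n])
  then have "det (G + mat n n (\<lambda>(a, b). s * u $ a * u $ b)) = det G * det (1\<^sub>m n - (H * U) * V)"
    using det_mult[OF G, of "1\<^sub>m n - (H * U) * V"] H(1) U V by (metis minus_carrier_mat mult_carrier_mat)
  also have "det (1\<^sub>m n - (H * U) * V) = det (1\<^sub>m 1 - V * (H * U))"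
    using sylvester_det[of "H * U" n 1 V 1] H(1) U V one_smult[of n] one_smult[of 1] by simp
  also have "det (1\<^sub>m 1 - V * (H * U)) = 1 - (V * (H * U)) $$ (0, 0)"
    using U V H by (subst det_single) auto
  also have "(V * (H * U)) $$ (0, 0) = - s * (u \<bullet> (H *\<^sub>v u))"
    using H(1) u unfolding U_def V_def
    by (simp add: scalar_prod_def sum_distrib_left sum_distrib_right algebra_simps sum_negf)
  finally show ?thesis by simp
qed

lemma det_nonzero_inverse:
  fixes G :: "'a :: field mat"
  assumes G: "G \<in> carrier_mat n n" and det: "det G \<noteq> 0"
  obtains H where "H \<in> carrier_mat n n" "G * H = 1\<^sub>m n" "H * G = 1\<^sub>m n"
proof
  let ?H = "(1 / det G) \<cdot>\<^sub>m adj_mat G"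
  show "?H \<in> carrier_mat n n" using adj_mat(1)[OF G] by simp
  show "G * ?H = 1\<^sub>m n"
    using adj_mat[OF G] det mult_smult_distrib[OF G adj_mat(1)[OF G]] by auto
  show "?H * G = 1\<^sub>m n"
    using adj_mat[OF G] det mult_smult_assoc_mat[OF adj_mat(1)[OF G] G] by auto
qed

lemma inverse_symmetric:
  fixes G :: "'a :: field mat"
  assumes G: "G \<in> carrier_mat n n" "G\<^sup>T = G" and H: "H \<in> carrier_mat n n" "G * H = 1\<^sub>m n"
  shows "H\<^sup>T = H"
proof -
  have "H\<^sup>T * G = 1\<^sub>m n" using transpose_mult[OF G(1) H(1)] G H by simp
  then have "H\<^sup>T * G * H = H" using H by simp
  then show ?thesis using G(1) H by (simp add: assoc_mult_mat[of _ n n _ n _ n])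
qed

lemma sum_insert_index:
  assumes "k < Suc L"
  shows "(\<Sum>j<Suc L. f j) = f k + (\<Sum>j<L. f (insert_index k j))"
proof -
  have "(\<Sum>j<Suc L. f j) = f k + sum f ({..<Suc L} - {k})"
    using assms by (subst sum.remove[of _ k]) auto
  also have "{..<Suc L} - {k} = insert_index k ` {..<L}"
    using insert_index_image[OF assms] by (simp add: lessThan_atLeast0)
  also have "sum f \<dots> = (\<Sum>j<L. f (insert_index k j))"
    by (subst sum.reindex) (auto intro: insert_index_inj_on)
  finally show ?thesis .
qed

text \<open>Deleting column \<open>k\<close> is a rank one update of the Gram matrix and multiplies
  its determinant by \<open>1 - col N k \<bullet> (H *\<^sub>v col N k)\<close>, with
  \<open>H\<close> its inverse. The subtracted terms add up to the trace of \<open>H * ?G\<close>,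
  which is \<open>r\<close>. If the Gram matrix is singular, the left side is 0.\<close>

lemma gram_column_deletion:
  fixes N :: "real mat"
  assumes N: "N \<in> carrier_mat r (Suc L)"
  defines "D \<equiv> \<lambda>k. mat r L (\<lambda>(i, j). N $$ (i, insert_index k j))"
  shows "(real (Suc L) - real r) * det (N * N\<^sup>T) \<le> (\<Sum>k<Suc L. det (D k * (D k)\<^sup>T))"
proof (cases "det (N * N\<^sup>T) = 0")
  case True
  have "(\<Sum>k<Suc L. det (D k * (D k)\<^sup>T)) \<ge> 0"
    by (intro sum_nonneg gram_det_nonneg) (auto simp: D_def)
  then show ?thesis using True by simp
next
  case False
  let ?G = "N * N\<^sup>T"
  have G: "?G \<in> carrier_mat r r" using N by simp
  obtain H where H: "H \<in> carrier_mat r r" "?G * H = 1\<^sub>m r" "H * ?G = 1\<^sub>m r"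
    using det_nonzero_inverse[OF G False] by blast
  have D: "D k * (D k)\<^sup>T = ?G + mat r r (\<lambda>(a, b). - 1 * col N k $ a * col N k $ b)" if k: "k < Suc L" for k
  proof (rule eq_matI)
    fix a b assume "a < dim_row (?G + mat r r (\<lambda>(a, b). - 1 * col N k $ a * col N k $ b))"
      "b < dim_col (?G + mat r r (\<lambda>(a, b). - 1 * col N k $ a * col N k $ b))"
    then have ab: "a < r" "b < r" by auto
    have "(D k * (D k)\<^sup>T) $$ (a, b) = (\<Sum>j<L. N $$ (a, insert_index k j) * N $$ (b, insert_index k j))"
      using ab unfolding D_def by (simp add: scalar_prod_def atLeast0LessThan)
    also have "\<dots> = (\<Sum>j<Suc L. N $$ (a, j) * N $$ (b, j)) - N $$ (a, k) * N $$ (b, k)"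
      using sum_insert_index[OF k, of "\<lambda>j. N $$ (a, j) * N $$ (b, j)"] by simp
    also have "\<dots> = (?G + mat r r (\<lambda>(a, b). - 1 * col N k $ a * col N k $ b)) $$ (a, b)"
      using ab N k by (simp add: scalar_prod_def atLeast0LessThan)
    finally show "(D k * (D k)\<^sup>T) $$ (a, b) = (?G + mat r r (\<lambda>(a, b). - 1 * col N k $ a * col N k $ b)) $$ (a, b)" .
  qed (use N in \<open>auto simp: D_def\<close>)
  have "(\<Sum>k<Suc L. det (D k * (D k)\<^sup>T)) = (\<Sum>k<Suc L. det ?G * (1 - col N k \<bullet> (H *\<^sub>v col N k)))"
  proof (intro sum.cong refl)
    fix k assume "k \<in> {..<Suc L}"
    then show "det (D k * (D k)\<^sup>T) = det ?G * (1 - col N k \<bullet> (H *\<^sub>v col N k))"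
      using det_rank_one_update[OF G H(1,2), of "col N k" "- 1"] D[of k] N by simp
  qed
  also have "\<dots> = det ?G * (real (Suc L) - (\<Sum>k<Suc L. col N k \<bullet> (H *\<^sub>v col N k)))"
    by (simp add: sum_subtractf flip: sum_distrib_left del: sum.lessThan_Suc)
  also have "(\<Sum>k<Suc L. col N k \<bullet> (H *\<^sub>v col N k)) = (\<Sum>k<Suc L. \<Sum>a<r. \<Sum>b<r. H $$ (a, b) * (N $$ (b, k) * N $$ (a, k)))"
    using N H(1) by (intro sum.cong refl) (simp add: scalar_prod_def atLeast0LessThan sum_distrib_left ac_simps)
  also have "\<dots> = (\<Sum>a<r. \<Sum>b<r. \<Sum>k<Suc L. H $$ (a, b) * (N $$ (b, k) * N $$ (a, k)))"
    by (subst sum.swap, rule sum.cong[OF refl], rule sum.swap)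
  also have "\<dots> = (\<Sum>a<r. \<Sum>b<r. H $$ (a, b) * ?G $$ (b, a))"
    using N by (intro sum.cong refl) (simp add: scalar_prod_def atLeast0LessThan sum_distrib_left del: sum.lessThan_Suc)
  also have "\<dots> = (\<Sum>a<r. (H * ?G) $$ (a, a))"
    using N H(1) by (intro sum.cong refl) (simp add: scalar_prod_def atLeast0LessThan)
  also have "\<dots> = real r" unfolding H(3) by simp
  finally show ?thesis by (simp add: mult.commute)
qed

text \<open>With \<open>w\<close> the squared norm of \<open>z\<close> and \<open>t\<close> the
  coefficient of the last row along \<open>z\<close>, \<open>det (D * D\<^sup>T)\<close> minus
  \<open>t\<^sup>2 * w * det (R * R\<^sup>T)\<close> is the Gram determinant of \<open>D0\<close>,
  hence nonnegative. Multiplying by \<open>w\<close> removes the quotient in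
  \<open>t\<close>.\<close>

lemma gram_border:
  fixes D :: "real mat"
  assumes D: "D \<in> carrier_mat (Suc r) L" and z: "z \<in> carrier_vec L"
    and orth: "\<And>i. i < r \<Longrightarrow> row D i \<bullet> z = 0"
  defines "R \<equiv> mat r L (\<lambda>(i, j). D $$ (i, j))"
  shows "det (R * R\<^sup>T) * (row D r \<bullet> z)\<^sup>2 \<le> det (D * D\<^sup>T) * (z \<bullet> z)"
proof (cases "z = 0\<^sub>v L")
  case True
  have "row D r \<in> carrier_vec L" using D by auto
  then have "row D r \<bullet> z = 0" unfolding True by (rule scalar_prod_right_zero)
  moreover have "z \<bullet> z = 0" unfolding True by simp
  ultimately show ?thesis by simp
next
  case False
  define w where "w = z \<bullet> z"
  have w: "w > 0" unfolding w_def
    using False scalar_prod_self_eq_0[OF z] scalar_prod_self_nonneg[of z] by linarith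
  define t where "t = (row D r \<bullet> z) / w"
  \<comment> \<open>Projecting the last row onto the complement of \<open>z\<close> changes only the last diagonal entry of the
    Gram matrix.\<close>
  define D0 where "D0 = mat (Suc r) L (\<lambda>(i, j). D $$ (i, j) - (if i = r then t * z $ j else 0))"
  have D0: "D0 \<in> carrier_mat (Suc r) L" unfolding D0_def by simp
  let ?W = "D * D\<^sup>T" and ?Wz = "D0 * D0\<^sup>T"
  have W: "?W \<in> carrier_mat (Suc r) (Suc r)" and W0: "?Wz \<in> carrier_mat (Suc r) (Suc r)" using D D0 by auto
  have row: "(\<Sum>j<L. D $$ (i, j) * z $ j) = (if i = r then t * w else 0)" if i: "i < Suc r" for i
  proof -
    have "(\<Sum>j<L. D $$ (i, j) * z $ j) = row D i \<bullet> z"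
      using D z i by (simp add: scalar_prod_def atLeast0LessThan)
    then show ?thesis using orth[of i] i w unfolding t_def by (cases "i = r") auto
  qed
  have zz: "(\<Sum>j<L. z $ j * z $ j) = w"
    unfolding w_def using z by (simp add: scalar_prod_def atLeast0LessThan)
  have ent: "?Wz $$ (a, b) = ?W $$ (a, b) - (if a = r \<and> b = r then t\<^sup>2 * w else 0)"
    if ab: "a < Suc r" "b < Suc r" for a b
  proof -
    let ?s = "\<lambda>i. if i = r then t else 0"
    have "?Wz $$ (a, b) = (\<Sum>j<L. (D $$ (a, j) - ?s a * z $ j) * (D $$ (b, j) - ?s b * z $ j))"
      using ab D0 unfolding D0_def by (auto simp: scalar_prod_def atLeast0LessThan intro!: sum.cong)
    also have "\<dots> = (\<Sum>j<L. D $$ (a, j) * D $$ (b, j)) - ?s a * (\<Sum>j<L. D $$ (b, j) * z $ j)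
        - ?s b * (\<Sum>j<L. D $$ (a, j) * z $ j) + ?s a * ?s b * (\<Sum>j<L. z $ j * z $ j)"
      unfolding sum_distrib_left sum_subtractf[symmetric] sum.distrib[symmetric]
      by (intro sum.cong refl) (simp add: algebra_simps)
    also have "\<dots> = ?W $$ (a, b) - (if a = r \<and> b = r then t\<^sup>2 * w else 0)"
      using ab D unfolding row[OF ab(1)] row[OF ab(2)] zz
      by (auto simp: scalar_prod_def atLeast0LessThan power2_eq_square)
    finally show ?thesis .
  qed
  \<comment> \<open>Minors that delete row \<open>r\<close> avoid the one entry in which the two
    Gram matrices differ, so the expansions along row \<open>r\<close> share their
    cofactors.\<close>
  have mdel: "mat_delete ?Wz r j = mat_delete ?W r j" if "j < Suc r" for j
  proof (rule eq_matI)
    fix a b assume "a < dim_row (mat_delete ?W r j)" "b < dim_col (mat_delete ?W r j)"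
    then have ab: "a < r" "b < r" using W by auto
    then have "?Wz $$ (a, insert_index j b) = ?W $$ (a, insert_index j b)"
      by (subst ent) (auto simp: insert_index_def)
    then show "mat_delete ?Wz r j $$ (a, b) = mat_delete ?W r j $$ (a, b)"
      using mat_delete_index[OF W lessI that ab] mat_delete_index[OF W0 lessI that ab] ab by simp
  qed (use D D0 in auto)
  have R: "mat_delete ?W r r = R * R\<^sup>T"
    using D unfolding mat_delete_def R_def by (intro eq_matI) (auto simp: scalar_prod_def)
  have "det ?Wz = (\<Sum>j<Suc r. ?Wz $$ (r, j) * cofactor ?Wz r j)"
    by (rule laplace_expansion_row[OF W0]) simp
  also have "\<dots> = (\<Sum>j<Suc r. ?W $$ (r, j) * cofactor ?W r j - (if j = r then t\<^sup>2 * w * cofactor ?W r r else 0))"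
  proof (intro sum.cong refl)
    fix j assume "j \<in> {..<Suc r}"
    then have j: "j < Suc r" by simp
    have "cofactor ?Wz r j = cofactor ?W r j" unfolding cofactor_def mdel[OF j] ..
    then show "?Wz $$ (r, j) * cofactor ?Wz r j = ?W $$ (r, j) * cofactor ?W r j - (if j = r then t\<^sup>2 * w * cofactor ?W r r else 0)"
      unfolding ent[OF lessI j] by (cases "j = r") (simp_all only: left_diff_distrib if_True if_False, simp_all)
  qed
  also have "\<dots> = det ?W - t\<^sup>2 * w * cofactor ?W r r"
    unfolding sum_subtractf laplace_expansion_row[OF W lessI, symmetric] by (simp del: sum.lessThan_Suc)
  also have "cofactor ?W r r = det (R * R\<^sup>T)" unfolding cofactor_def R by simp
  finally have "det ?W \<ge> t\<^sup>2 * w * det (R * R\<^sup>T)" using gram_det_nonneg[OF D0] by simp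
  then have "t\<^sup>2 * w * det (R * R\<^sup>T) * w \<le> det ?W * w" using w by (intro mult_right_mono) auto
  moreover have "t\<^sup>2 * w * det (R * R\<^sup>T) * w = det (R * R\<^sup>T) * (row D r \<bullet> z)\<^sup>2"
    using w unfolding t_def by (simp add: power2_eq_square)
  ultimately show ?thesis unfolding w_def by simp
qed

lemma mat_delete_gram_select_mat:
  fixes M :: "real mat"
  assumes "i < Suc r"
  shows "mat_delete (select_mat M (Suc r) c f g * (select_mat M (Suc r) c f g)\<^sup>T) i i =
    select_mat M r c (f \<circ> insert_index i) g * (select_mat M r c (f \<circ> insert_index i) g)\<^sup>T"
  using assms unfolding mat_delete_def
  by (intro eq_matI) (auto simp: scalar_prod_def insert_index_def)

text \<open>With \<open>?W\<close> the Gram matrix of the bordered block, \<open>border\<close> and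
  eigenvalue comparison bound \<open>\<gamma>\<^sup>2 * V\<close> times the reciprocal sum for
  \<open>M\<close> by \<open>det ?W\<close> times the one for \<open>?W\<close>. That is the sum of
  the \<open>r + 1\<close> principal minors, each at most \<open>K * V\<close>. For nonzero
  \<open>\<gamma>\<close>, \<open>border\<close> also makes \<open>?W\<close> nonsingular, so that
  reciprocals can be compared.\<close>

lemma gram_det_ratio_bound:
  fixes M :: "real mat"
  assumes M: "M \<in> carrier_mat m n"
    and f: "inj_on f {..<Suc r}" "f ` {..<Suc r} \<subseteq> {..<m}"
    and g: "inj_on g {..<c}" "g ` {..<c} \<subseteq> {..<n}"
    and V: "V > 0" "K \<ge> 0"
    and row_del: "\<And>i. i < Suc r \<Longrightarrow> det (select_mat M r c (f \<circ> insert_index i) g *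
      (select_mat M r c (f \<circ> insert_index i) g)\<^sup>T) \<le> K * V"
    and border: "\<gamma>\<^sup>2 * V \<le> det (select_mat M (Suc r) c f g * (select_mat M (Suc r) c f g)\<^sup>T)"
  shows "\<gamma>\<^sup>2 * (\<Sum>k<Suc r. 1 / eigs (M * M\<^sup>T) ! k) \<le> real (Suc r) * K"
proof (cases "\<gamma> = 0")
  case True
  then show ?thesis using V by simp
next
  case False
  let ?D = "select_mat M (Suc r) c f g"
  let ?W = "?D * ?D\<^sup>T"
  have W: "?W \<in> carrier_mat (Suc r) (Suc r)" by (rule mult_carrier_mat[of _ _ c]) auto
  note sym = gram_symmetric[of ?D]
  have "0 < \<gamma>\<^sup>2 * V" using False V by simp
  then have det: "det ?W > 0" using border by linarith
  have pos: "eigs ?W ! k > 0" if k: "k < Suc r" for k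
  proof -
    have "eigs ?W ! k \<noteq> 0"
      using det k prod_zero[of "{..<Suc r}" "\<lambda>k. eigs ?W ! k"] unfolding det_eq_prod_eigs[OF W sym]
      by (metis finite_lessThan lessThan_iff less_irrefl)
    then show ?thesis using gram_eigs_nonneg[OF select_mat_carrier k, of M c f g] by linarith
  qed
  have posM: "eigs (M * M\<^sup>T) ! k > 0" if k: "k < Suc r" for k
    using pos[OF k] eigs_gram_select_mat_le[OF M f g k] by linarith
  have "(\<Sum>k<Suc r. 1 / eigs (M * M\<^sup>T) ! k) \<le> (\<Sum>k<Suc r. 1 / eigs ?W ! k)"
    using pos posM eigs_gram_select_mat_le[OF M f g] by (intro sum_mono divide_left_mono mult_pos_pos) auto
  then have "\<gamma>\<^sup>2 * V * (\<Sum>k<Suc r. 1 / eigs (M * M\<^sup>T) ! k) \<le> det ?W * (\<Sum>k<Suc r. 1 / eigs ?W ! k)"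
    using border det
    by (intro mult_mono) (auto simp del: sum.lessThan_Suc intro!: sum_nonneg less_imp_le[OF posM])
  also have "\<dots> = (\<Sum>i<Suc r. det (mat_delete ?W i i))"
    by (rule sum_principal_minors[symmetric, OF W sym]) (use det in simp)
  also have "\<dots> \<le> (\<Sum>i<Suc r. K * V)"
    by (intro sum_mono) (use row_del in \<open>auto simp: mat_delete_gram_select_mat\<close>)
  also have "\<dots> = real (Suc r) * K * V" by simp
  finally have "V * (\<gamma>\<^sup>2 * (\<Sum>k<Suc r. 1 / eigs (M * M\<^sup>T) ! k)) \<le> V * (real (Suc r) * K)"
    by (simp only: ac_simps)
  then show ?thesis using V by simp
qed

section \<open>The Moore-Penrose inverse\<close>

text \<open>The symmetric projections \<open>A * X\<close> and \<open>A * Y\<close> absorb each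
  other and so coincide, and likewise \<open>X * A\<close> and \<open>Y * A\<close>; then
  \<open>X = X * A * X\<close> can be rewritten into \<open>Y * A * Y\<close>.\<close>

lemma pseudo_inverse_unique:
  assumes X: "is_pseudo_inverse A X" and Y: "is_pseudo_inverse A Y"
  shows "X = Y"
proof -
  let ?n = "dim_row A" and ?k = "dim_col A"
  have A: "A \<in> carrier_mat ?n ?k" by simp
  have c: "X \<in> carrier_mat ?k ?n" "Y \<in> carrier_mat ?k ?n"
    using X Y unfolding is_pseudo_inverse_def by auto
  have x: "A * X * A = A" "X * A * X = X" "(A * X)\<^sup>T = A * X" "(X * A)\<^sup>T = X * A"
    and y: "A * Y * A = A" "Y * A * Y = Y" "(A * Y)\<^sup>T = A * Y" "(Y * A)\<^sup>T = Y * A"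
    using X Y unfolding is_pseudo_inverse_def by auto
  have "A * X = (A * Y * A) * X" by (simp only: y(1))
  also have "\<dots> = (A * Y) * (A * X)"
    by (rule assoc_mult_mat[OF mult_carrier_mat[OF A c(2)] A c(1)])
  also have "\<dots> = (A * Y)\<^sup>T * (A * X)\<^sup>T" by (simp only: x(3) y(3))
  also have "\<dots> = ((A * X) * (A * Y))\<^sup>T"
    by (rule transpose_mult[symmetric, OF mult_carrier_mat[OF A c(1)] mult_carrier_mat[OF A c(2)]])
  also have "(A * X) * (A * Y) = A * X * A * Y"
    by (rule assoc_mult_mat[symmetric, OF mult_carrier_mat[OF A c(1)] A c(2)])
  also have "\<dots> = A * Y" by (simp only: x(1))
  finally have AX: "A * X = A * Y" using y(3) by simp
  have "X * A = X * (A * Y * A)" by (simp only: y(1))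
  also have "\<dots> = X * (A * (Y * A))" by (simp only: assoc_mult_mat[OF A c(2) A])
  also have "\<dots> = (X * A) * (Y * A)"
    by (rule assoc_mult_mat[symmetric, OF c(1) A mult_carrier_mat[OF c(2) A]])
  also have "\<dots> = (X * A)\<^sup>T * (Y * A)\<^sup>T" by (simp only: x(4) y(4))
  also have "\<dots> = ((Y * A) * (X * A))\<^sup>T"
    by (rule transpose_mult[symmetric, OF mult_carrier_mat[OF c(2) A] mult_carrier_mat[OF c(1) A]])
  also have "(Y * A) * (X * A) = Y * (A * (X * A))"
    by (rule assoc_mult_mat[OF c(2) A mult_carrier_mat[OF c(1) A]])
  also have "\<dots> = Y * (A * X * A)" by (simp only: assoc_mult_mat[OF A c(1) A])
  also have "\<dots> = Y * A" by (simp only: x(1))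
  finally have XA: "X * A = Y * A" using y(4) by simp
  have "X = X * A * X" by (simp only: x(2))
  also have "\<dots> = X * (A * X)" by (rule assoc_mult_mat[OF c(1) A c(1)])
  also have "\<dots> = X * (A * Y)" by (simp only: AX)
  also have "\<dots> = X * A * Y" by (rule assoc_mult_mat[symmetric, OF c(1) A c(2)])
  also have "\<dots> = Y" by (simp only: XA y(2))
  finally show ?thesis .
qed

text \<open>\<open>A\<^sup>T * H\<close> is a right inverse of \<open>A\<close>, which settles three
  Penrose conditions; the fourth follows from the symmetry of \<open>H\<close>. The error analysis
  uses it to solve \<open>A *\<^sub>v y = b\<close> and to project orthogonally onto the row
  space.\<close>

lemma pseudo_inverse_full_row_rank:
  fixes A :: "real mat"
  assumes A: "A \<in> carrier_mat n k" and H: "H \<in> carrier_mat n n" "A * A\<^sup>T * H = 1\<^sub>m n"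
  shows "pseudo_inverse A = A\<^sup>T * H" "A * (A\<^sup>T * H) = 1\<^sub>m n" "(A\<^sup>T * H * A)\<^sup>T = A\<^sup>T * H * A"
proof -
  let ?X = "A\<^sup>T * H"
  have At: "A\<^sup>T \<in> carrier_mat k n" using A by simp
  have X: "?X \<in> carrier_mat k n" using At H by simp
  have Ht: "H\<^sup>T = H" by (rule inverse_symmetric[OF _ gram_symmetric H]) (use A in simp)
  show AX: "A * ?X = 1\<^sub>m n" using assoc_mult_mat[OF A At H(1)] H(2) by simp
  show XA: "(?X * A)\<^sup>T = ?X * A"
    using mat_sandwich_transpose[OF H(1) Ht A] .
  have "?X * A * ?X = ?X * (A * ?X)" by (rule assoc_mult_mat[OF X A X])
  also have "\<dots> = ?X" unfolding AX using X by (rule right_mult_one_mat)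
  finally have "?X * A * ?X = ?X" .
  then have "is_pseudo_inverse A ?X"
    unfolding is_pseudo_inverse_def using A X AX XA by auto
  then show "pseudo_inverse A = ?X"
    unfolding pseudo_inverse_def using pseudo_inverse_unique by blast
qed

section \<open>Rank and nonsingular submatrices\<close>

lemma nonsingular_columns:
  fixes M :: "real mat"
  assumes "r \<le> L" "inj_on g {..<L}" "det (select_mat M r L f g * (select_mat M r L f g)\<^sup>T) \<noteq> 0"
  shows "\<exists>h. inj_on h {..<r} \<and> h ` {..<r} \<subseteq> g ` {..<L} \<and>
    det (select_mat M r r f h * (select_mat M r r f h)\<^sup>T) \<noteq> 0"
  using assms
proof (induction L arbitrary: g)
  case 0
  then show ?case by auto
next
  case (Suc L)
  show ?case
  proof (cases "r = Suc L")
    case True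
    then show ?thesis using Suc.prems by blast
  next
    case False
    then have r: "r \<le> L" using Suc.prems(1) by simp
    let ?N = "select_mat M r (Suc L) f g"
    have D: "mat r L (\<lambda>(i, j). ?N $$ (i, insert_index k j)) = select_mat M r L f (g \<circ> insert_index k)" for k
      by (rule eq_matI) (auto simp: insert_index_def)
    have "det (?N * ?N\<^sup>T) > 0"
      using Suc.prems(3) gram_det_nonneg[OF select_mat_carrier] by (metis less_eq_real_def)
    then have "0 < (real (Suc L) - real r) * det (?N * ?N\<^sup>T)" using r by simp
    also have "\<dots> \<le> (\<Sum>k<Suc L. det (select_mat M r L f (g \<circ> insert_index k) * (select_mat M r L f (g \<circ> insert_index k))\<^sup>T))"
      using gram_column_deletion[OF select_mat_carrier[of M r "Suc L" f g]] unfolding D .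
    finally obtain k where k: "k < Suc L"
      and det: "det (select_mat M r L f (g \<circ> insert_index k) * (select_mat M r L f (g \<circ> insert_index k))\<^sup>T) \<noteq> 0"
      by (metis (no_types, lifting) lessThan_iff less_irrefl sum.neutral)
    have im: "insert_index k ` {..<L} \<subseteq> {..<Suc L}" by (auto simp: insert_index_def)
    have "inj_on (g \<circ> insert_index k) {..<L}"
      by (intro comp_inj_on insert_index_inj_on inj_on_subset[OF Suc.prems(2) im])
    from Suc.IH[OF r this det] obtain h where h: "inj_on h {..<r}" "h ` {..<r} \<subseteq> (g \<circ> insert_index k) ` {..<L}"
      "det (select_mat M r r f h * (select_mat M r r f h)\<^sup>T) \<noteq> 0" by blast
    then have "h ` {..<r} \<subseteq> g ` {..<Suc L}" using im by (auto simp: image_comp[symmetric])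
    then show ?thesis using h by blast
  qed
qed

lemma det_gram_square:
  fixes S :: "real mat"
  assumes "S \<in> carrier_mat n n"
  shows "det (S * S\<^sup>T) = (det S)\<^sup>2"
  using assms det_mult[OF assms, of "S\<^sup>T"] det_transpose[OF assms] by (simp add: power2_eq_square)

text \<open>The bound by \<open>n\<close> holds because the rank is the size of a maximal
  independent set of columns, which lie in an \<open>n\<close>-dimensional space.\<close>

lemma mat_rank_le_dims:
  assumes A: "A \<in> carrier_mat n k"
  shows "mat_rank A \<le> n" "mat_rank A \<le> k"
proof -
  interpret vec_space "TYPE(real)" n .
  show "mat_rank A \<le> k" unfolding mat_rank_def using A rank_le_nc[OF A] by simp
  obtain S where S: "maximal S (\<lambda>T. T \<subseteq> set (cols A) \<and> lin_indpt T)"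
    using maximal_exists[of "(\<lambda>T. T \<subseteq> set (cols A) \<and> lin_indpt T)" "card (set (cols A))" "{}"]
    by (meson List.finite_set card_mono empty_iff empty_subsetI finite_lin_indpt2 rev_finite_subset)
  then have "S \<subseteq> carrier_vec n" "lin_indpt S"
    using cols_dim[of A] A unfolding maximal_def by auto
  then have "card S \<le> n" using li_le_dim(2)[OF fin_dim, of S] dim_is_n by simp
  then show "mat_rank A \<le> n" unfolding mat_rank_def using A rank_card_indpt[OF A S] by simp
qed

text \<open>By \<open>nonsingular_columns\<close>, \<open>r\<close> of the columns form a
  nonsingular square matrix and are therefore independent; the number of rows bounds the rank from
  above.\<close>

lemma mat_rank_eq_if_gram_det_nonzero:
  assumes A: "A \<in> carrier_mat r q" and rq: "r \<le> q" and det: "det (A * A\<^sup>T) \<noteq> 0"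
  shows "mat_rank A = r"
proof -
  interpret vec_space "TYPE(real)" r .
  have "select_mat A r q id id = A" using A by (intro eq_matI) auto
  then have "det (select_mat A r q id id * (select_mat A r q id id)\<^sup>T) \<noteq> 0" using det by simp
  from nonsingular_columns[OF rq inj_on_id this] obtain h where h: "h ` {..<r} \<subseteq> {..<q}"
    and dh: "det (select_mat A r r id h * (select_mat A r r id h)\<^sup>T) \<noteq> 0"
    by auto
  define S where "S = select_mat A r r id h"
  have S: "S \<in> carrier_mat r r" unfolding S_def by simp
  have dS: "det S \<noteq> 0" using dh det_gram_square[OF S] unfolding S_def by simp
  have sub: "set (cols S) \<subseteq> set (cols A)"
  proof
    fix v assume "v \<in> set (cols S)"
    then obtain j where j: "j < r" "v = col S j" using S by (auto simp: cols_def)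
    have "h j < q" using h j by auto
    moreover from this have "col S j = col A (h j)"
      using j(1) A unfolding S_def by (intro eq_vecI) auto
    ultimately show "v \<in> set (cols A)" using A j by (auto simp: cols_def)
  qed
  have rk: "rank S = r" by (rule low_rank_det_zero[OF S dS])
  then have dist: "distinct (cols S)" using non_distinct_low_rank[OF S] by auto
  have "lin_indpt (set (cols S))" by (rule full_rank_lin_indpt[OF S rk dist])
  from rank_ge_card_indpt[OF A sub this] have "rank A \<ge> r"
    using distinct_card[OF dist] S by simp
  then show ?thesis using mat_rank_le_dims(1)[OF A] A unfolding mat_rank_def by simp
qed

text \<open>First \<open>r\<close> independent columns are chosen; then
  \<open>nonsingular_columns\<close>, applied to the transpose of that column block, chooses the
  rows.\<close>

lemma nonsingular_square_submatrix:
  fixes M :: "real mat"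
  assumes M: "M \<in> carrier_mat m n" and r: "r \<le> mat_rank M"
  shows "\<exists>f g. inj_on f {..<r} \<and> f ` {..<r} \<subseteq> {..<m} \<and> inj_on g {..<r} \<and> g ` {..<r} \<subseteq> {..<n} \<and>
    det (select_mat M r r f g * (select_mat M r r f g)\<^sup>T) \<noteq> 0"
proof -
  interpret vec_space "TYPE(real)" m .
  obtain S where S: "maximal S (\<lambda>T. T \<subseteq> set (cols M) \<and> lin_indpt T)"
    using maximal_exists[of "(\<lambda>T. T \<subseteq> set (cols M) \<and> lin_indpt T)" "card (set (cols M))" "{}"]
    by (meson List.finite_set card_mono empty_iff empty_subsetI finite_lin_indpt2 rev_finite_subset)
  then have Sc: "S \<subseteq> set (cols M)" "lin_indpt S" unfolding maximal_def by auto
  have "r \<le> card S" using r rank_card_indpt[OF M S] M unfolding mat_rank_def by simp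
  then obtain T where T: "T \<subseteq> S" "card T = r" "finite T" by (metis obtain_subset_with_card_n)
  obtain xs where xs: "set xs = T" "distinct xs" using finite_distinct_list[OF T(3)] by blast
  have len: "length xs = r" using xs T(2) distinct_card by fastforce
  have "\<exists>j<n. col M j = xs ! k" if "k < r" for k
  proof -
    have "xs ! k \<in> set (cols M)" using that len xs(1) T(1) Sc(1) nth_mem[of k xs] by blast
    then show ?thesis using M unfolding cols_def by auto
  qed
  then obtain g where g: "\<And>k. k < r \<Longrightarrow> g k < n" "\<And>k. k < r \<Longrightarrow> col M (g k) = xs ! k" by metis
  have ginj: "inj_on g {..<r}"
    using xs(2) len g(2) by (intro inj_onI) (metis lessThan_iff nth_eq_iff_index_eq)
  define N where "N = select_mat M m r id g"
  have N: "N \<in> carrier_mat m r" unfolding N_def by simp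
  have colsN: "cols N = xs"
  proof (rule nth_equalityI)
    fix k assume "k < length (cols N)"
    then have k: "k < r" using N by simp
    have "col N k = col M (g k)" using k g(1) M unfolding N_def by (intro eq_vecI) auto
    then show "cols N ! k = xs ! k" using k N g(2) by simp
  qed (use N len in simp)
  have li: "lin_indpt (set (cols N))"
    unfolding colsN xs(1) by (rule subset_li_is_li[OF Sc(2) T(1)])
  have Nt: "N\<^sup>T \<in> carrier_mat r m" using N by simp
  have "det (N\<^sup>T * (N\<^sup>T)\<^sup>T) \<noteq> 0"
  proof
    assume "det (N\<^sup>T * (N\<^sup>T)\<^sup>T) = 0"
    then obtain x where "x \<in> carrier_vec r" "x \<noteq> 0\<^sub>v r" "N *\<^sub>v x = 0\<^sub>v m"
      using gram_det_eq_0_iff[OF Nt] by auto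
    then show False using lin_depI[OF N, of x] xs(2) li unfolding colsN by blast
  qed
  moreover have "N\<^sup>T = select_mat (M\<^sup>T) r m g id"
    unfolding N_def using M g(1) by (intro eq_matI) auto
  moreover have "r \<le> m" using r mat_rank_le_dims(1)[OF M] by simp
  ultimately obtain h where h: "inj_on h {..<r}" "h ` {..<r} \<subseteq> id ` {..<m}"
    and dh: "det (select_mat (M\<^sup>T) r r g h * (select_mat (M\<^sup>T) r r g h)\<^sup>T) \<noteq> 0"
    using nonsingular_columns[of r m id "M\<^sup>T" g] by auto
  have "select_mat (M\<^sup>T) r r g h = (select_mat M r r h g)\<^sup>T"
  proof (rule eq_matI)
    fix i j assume "i < dim_row ((select_mat M r r h g)\<^sup>T)" "j < dim_col ((select_mat M r r h g)\<^sup>T)"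
    then have ij: "i < r" "j < r" by auto
    then have "h j < m" using h(2) by auto
    then show "select_mat (M\<^sup>T) r r g h $$ (i, j) = (select_mat M r r h g)\<^sup>T $$ (i, j)"
      using ij g(1) M by simp
  qed auto
  then have "det (select_mat M r r h g) \<noteq> 0"
    using dh det_gram_square[of "select_mat (M\<^sup>T) r r g h" r] det_transpose[of "select_mat M r r h g" r] by simp
  then have "det (select_mat M r r h g * (select_mat M r r h g)\<^sup>T) \<noteq> 0"
    using det_gram_square[of "select_mat M r r h g" r] by simp
  then show ?thesis using h ginj g(1) by (intro exI[of _ h] exI[of _ g]) auto
qed

text \<open>A linear dependence among the rows survives the removal of columns, so it cannot exist
  for the larger block.\<close>

lemma gram_det_nonzero_more_columns:
  fixes M :: "real mat"
  assumes det: "det (select_mat M r L f g * (select_mat M r L f g)\<^sup>T) \<noteq> 0" and le: "L \<le> q"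
    and eq: "\<And>j. j < L \<Longrightarrow> g' j = g j"
  shows "det (select_mat M r q f g' * (select_mat M r q f g')\<^sup>T) \<noteq> 0"
proof
  assume "det (select_mat M r q f g' * (select_mat M r q f g')\<^sup>T) = 0"
  from iffD1[OF gram_det_eq_0_iff[OF select_mat_carrier] this]
  obtain x where x: "x \<in> carrier_vec r" "x \<noteq> 0\<^sub>v r" and z: "(select_mat M r q f g')\<^sup>T *\<^sub>v x = 0\<^sub>v q"
    by metis
  have "(select_mat M r L f g)\<^sup>T *\<^sub>v x = 0\<^sub>v L"
  proof (rule eq_vecI)
    fix j assume "j < dim_vec (0\<^sub>v L :: real vec)"
    then have j: "j < L" "j < q" using le by auto
    then have "col (select_mat M r L f g) j = col (select_mat M r q f g') j"
      using eq by (intro eq_vecI) auto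
    then show "((select_mat M r L f g)\<^sup>T *\<^sub>v x) $ j = 0\<^sub>v L $ j"
      using arg_cong[OF z, of "\<lambda>v. v $ j"] j by simp
  qed simp
  then have "det (select_mat M r L f g * (select_mat M r L f g)\<^sup>T) = 0"
    using x by (intro iffD2[OF gram_det_eq_0_iff[OF select_mat_carrier]]) metis
  then show False using det by simp
qed

subsection \<open>Pseudo skeleton approximations\<close>

text \<open>Makes every submatrix a leading block, so that maximality over permutations can be
  applied to it. The complements of domain and image have equal size, and any bijection between them
  completes \<open>g\<close>.\<close>

lemma inj_on_extends_to_permutation:
  fixes g :: "nat \<Rightarrow> nat"
  assumes g: "inj_on g {..<r}" "g ` {..<r} \<subseteq> {..<n}"
  obtains \<pi> where "\<pi> permutes {..<n}" "\<And>i. i < r \<Longrightarrow> \<pi> i = g i"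
proof -
  have r: "r \<le> n" using card_mono[OF _ g(2)] card_image[OF g(1)] by simp
  have "card ({..<n} - {..<r}) = card ({..<n} - g ` {..<r})"
    using r g by (simp add: card_Diff_subset card_image)
  then obtain b where b: "bij_betw b ({..<n} - {..<r}) ({..<n} - g ` {..<r})"
    using finite_same_card_bij[of "{..<n} - {..<r}" "{..<n} - g ` {..<r}"] by auto
  define \<pi> where "\<pi> i = (if i < r then g i else if i < n then b i else i)" for i
  have "bij_betw \<pi> {..<r} (g ` {..<r})"
    using g(1) by (subst bij_betw_cong[of _ _ g]) (auto simp: \<pi>_def bij_betw_def)
  moreover have "bij_betw \<pi> ({..<n} - {..<r}) ({..<n} - g ` {..<r})"
    using b by (subst bij_betw_cong[of _ _ b]) (auto simp: \<pi>_def)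
  ultimately have "bij_betw \<pi> ({..<r} \<union> ({..<n} - {..<r})) (g ` {..<r} \<union> ({..<n} - g ` {..<r}))"
    by (rule bij_betw_combine) auto
  moreover have "{..<r} \<union> ({..<n} - {..<r}) = {..<n}" "g ` {..<r} \<union> ({..<n} - g ` {..<r}) = {..<n}"
    using r g(2) by auto
  ultimately have "\<pi> permutes {..<n}"
    using r by (intro bij_imp_permutes) (auto simp: \<pi>_def)
  then show ?thesis using that by (simp add: \<pi>_def)
qed

section \<open>Permutation matrices and the entries of the skeleton\<close>

definition perm_mat :: "nat \<Rightarrow> (nat \<Rightarrow> nat) \<Rightarrow> real mat" where
  "perm_mat n \<pi> = mat n n (\<lambda>(i, j). if j = \<pi> i then 1 else 0)"

lemma perm_mat_carrier [simp]: "perm_mat n \<pi> \<in> carrier_mat n n"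
  by (simp add: perm_mat_def)

lemma permutation_mat_iff: "permutation_mat n P \<longleftrightarrow> (\<exists>\<pi>. \<pi> permutes {..<n} \<and> P = perm_mat n \<pi>)"
  unfolding permutation_mat_def perm_mat_def ..

lemma perm_mat_mult:
  assumes M: "M \<in> carrier_mat n k" and p: "\<pi> permutes {..<n}"
  shows "perm_mat n \<pi> * M = mat n k (\<lambda>(i, j). M $$ (\<pi> i, j))"
proof (rule eq_matI)
  fix i j assume "i < dim_row (mat n k (\<lambda>(i, j). M $$ (\<pi> i, j)))" "j < dim_col (mat n k (\<lambda>(i, j). M $$ (\<pi> i, j)))"
  then have ij: "i < n" "j < k" by auto
  then have "\<pi> i < n" using permutes_in_image[OF p] by simp
  have "(perm_mat n \<pi> * M) $$ (i, j) = (\<Sum>l<n. (if l = \<pi> i then 1 else 0) * M $$ (l, j))"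
    using ij M unfolding perm_mat_def by (simp add: scalar_prod_def atLeast0LessThan)
  also have "\<dots> = M $$ (\<pi> i, j)" using \<open>\<pi> i < n\<close> by (simp add: if_distrib[of "\<lambda>c. c * _"] cong: if_cong)
  finally show "(perm_mat n \<pi> * M) $$ (i, j) = mat n k (\<lambda>(i, j). M $$ (\<pi> i, j)) $$ (i, j)" using ij by simp
qed (use M in \<open>auto simp: perm_mat_def\<close>)

lemma perm_mat_transpose:
  assumes p: "\<pi> permutes {..<n}"
  shows "(perm_mat n \<pi>)\<^sup>T = perm_mat n (inv_into UNIV \<pi>)"
  using permutes_inverses[OF p] unfolding perm_mat_def by (intro eq_matI) auto

lemma mult_perm_mat:
  assumes M: "M \<in> carrier_mat k n" and p: "\<pi> permutes {..<n}"
  shows "M * (perm_mat n \<pi>)\<^sup>T = mat k n (\<lambda>(i, j). M $$ (i, \<pi> j))"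
proof -
  have "(M * (perm_mat n \<pi>)\<^sup>T)\<^sup>T = perm_mat n \<pi> * M\<^sup>T"
    using M by (subst transpose_mult[of _ k n _ n]) auto
  also have "\<dots> = mat n k (\<lambda>(i, j). M\<^sup>T $$ (\<pi> i, j))"
    by (rule perm_mat_mult[OF _ p]) (use M in simp)
  finally have "M * (perm_mat n \<pi>)\<^sup>T = (mat n k (\<lambda>(i, j). M\<^sup>T $$ (\<pi> i, j)))\<^sup>T"
    by (metis transpose_transpose)
  also have "\<dots> = mat k n (\<lambda>(i, j). M $$ (i, \<pi> j))"
    using M permutes_in_image[OF p] by (intro eq_matI) auto
  finally show ?thesis .
qed

lemma permuted_matrix:
  assumes M: "M \<in> carrier_mat m n" and p: "\<pi> permutes {..<m}" "\<tau> permutes {..<n}"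
  shows "perm_mat m \<pi> * M * (perm_mat n \<tau>)\<^sup>T = select_mat M m n \<pi> \<tau>"
proof -
  have "mat m n (\<lambda>(i, j). M $$ (\<pi> i, j)) * (perm_mat n \<tau>)\<^sup>T =
      mat m n (\<lambda>(i, j). mat m n (\<lambda>(i, j). M $$ (\<pi> i, j)) $$ (i, \<tau> j))"
    by (rule mult_perm_mat[OF mat_carrier p(2)])
  also have "\<dots> = select_mat M m n \<pi> \<tau>"
  proof (rule eq_matI)
    fix i j assume "i < dim_row (select_mat M m n \<pi> \<tau>)" "j < dim_col (select_mat M m n \<pi> \<tau>)"
    then have ij: "i < m" "j < n" by auto
    then have "\<tau> j < n" using permutes_in_image[OF p(2)] by simp
    then show "mat m n (\<lambda>(i, j). mat m n (\<lambda>(i, j). M $$ (\<pi> i, j)) $$ (i, \<tau> j)) $$ (i, j) =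
        select_mat M m n \<pi> \<tau> $$ (i, j)"
      using ij by simp
  qed auto
  finally show ?thesis unfolding perm_mat_mult[OF M p(1)] .
qed

lemma leading_block_perm_mat:
  assumes M: "M \<in> carrier_mat m n" and p: "\<pi> permutes {..<m}" "\<tau> permutes {..<n}"
    and le: "a \<le> m" "c \<le> n"
  shows "leading_block M a c (perm_mat m \<pi>) (perm_mat n \<tau>) = select_mat M a c \<pi> \<tau>"
  unfolding leading_block_def permuted_matrix[OF M p] split_block_def Let_def
  using le by (auto intro!: eq_matI)

text \<open>The outer permutations undo those that bring the block to the corner, so an entry is a
  row of the left factor times the pseudo inverse times a column of the right factor. Addressing it
  as \<open>(\<pi> i, \<tau> j)\<close> keeps inverse permutations out of the formula. The dimension
  of the pseudo inverse is a hypothesis because a \<open>THE\<close> term has none by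
  itself.\<close>

lemma pseudo_skeleton_perm_mat_index:
  assumes M: "M \<in> carrier_mat m n" and p: "\<pi> permutes {..<m}" "\<tau> permutes {..<n}"
    and le: "a \<le> m" "c \<le> n" and ij: "i < m" "j < n"
    and X: "pseudo_inverse (select_mat M a c \<pi> \<tau>) \<in> carrier_mat c a"
  shows "pseudo_skeleton M a c (perm_mat m \<pi>) (perm_mat n \<tau>) \<in> carrier_mat m n"
    "pseudo_skeleton M a c (perm_mat m \<pi>) (perm_mat n \<tau>) $$ (\<pi> i, \<tau> j) =
     vec c (\<lambda>k. M $$ (\<pi> i, \<tau> k)) \<bullet> (pseudo_inverse (select_mat M a c \<pi> \<tau>) *\<^sub>v vec a (\<lambda>l. M $$ (\<pi> l, \<tau> j)))"
proof -
  let ?X = "pseudo_inverse (select_mat M a c \<pi> \<tau>)"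
  define F where "F = select_mat M m c \<pi> \<tau>"
  define G where "G = select_mat M a n \<pi> \<tau>"
  have F: "F \<in> carrier_mat m c" and G: "G \<in> carrier_mat a n" unfolding F_def G_def by auto
  define Y where "Y = F * ?X * G"
  have Y: "Y \<in> carrier_mat m n" unfolding Y_def using F G X by simp
  have "pseudo_skeleton M a c (perm_mat m \<pi>) (perm_mat n \<tau>) = (perm_mat m \<pi>)\<^sup>T * F * ?X * G * perm_mat n \<tau>"
  proof -
    obtain A B C D where sb: "split_block (select_mat M m n \<pi> \<tau>) a c = (A, B, C, D)"
      by (cases "split_block (select_mat M m n \<pi> \<tau>) a c") auto
    have A: "A = select_mat M a c \<pi> \<tau>"
      and B: "B = mat a (n - c) (\<lambda>(i, j). select_mat M m n \<pi> \<tau> $$ (i, j + c))"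
      and C: "C = mat (m - a) c (\<lambda>(i, j). select_mat M m n \<pi> \<tau> $$ (i + a, j))"
      using sb le unfolding split_block_def Let_def by (auto intro!: eq_matI)
    have "A @\<^sub>r C = F"
      unfolding A C F_def append_rows_def using le by (intro eq_matI) auto
    moreover have "append_columns A B = G"
      unfolding A B G_def append_columns_def using le by (intro eq_matI) auto
    ultimately show ?thesis
      unfolding pseudo_skeleton_def permuted_matrix[OF M p] sb by (simp add: A)
  qed
  also have "\<dots> = (perm_mat m \<pi>)\<^sup>T * Y * perm_mat n \<tau>"
  proof -
    have P: "(perm_mat m \<pi>)\<^sup>T \<in> carrier_mat m m" by simp
    have "(perm_mat m \<pi>)\<^sup>T * F * ?X * G = (perm_mat m \<pi>)\<^sup>T * (F * ?X) * G"
      by (simp only: assoc_mult_mat[OF P F X])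
    also have "\<dots> = (perm_mat m \<pi>)\<^sup>T * Y"
      unfolding Y_def by (rule assoc_mult_mat[OF P mult_carrier_mat[OF F X] G])
    finally show ?thesis by simp
  qed
  also have "\<dots> = perm_mat m (inv_into UNIV \<pi>) * Y * (perm_mat n (inv_into UNIV \<tau>))\<^sup>T"
    unfolding perm_mat_transpose[OF p(1)] perm_mat_transpose[OF permutes_inv[OF p(2)]]
    using permutes_inv_inv[OF p(2)] by simp
  also have "\<dots> = select_mat Y m n (inv_into UNIV \<pi>) (inv_into UNIV \<tau>)"
    by (rule permuted_matrix[OF Y permutes_inv[OF p(1)] permutes_inv[OF p(2)]])
  finally have ps: "pseudo_skeleton M a c (perm_mat m \<pi>) (perm_mat n \<tau>) = select_mat Y m n (inv_into UNIV \<pi>) (inv_into UNIV \<tau>)" .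
  show "pseudo_skeleton M a c (perm_mat m \<pi>) (perm_mat n \<tau>) \<in> carrier_mat m n" unfolding ps by simp
  have "\<pi> i < m" "\<tau> j < n" using permutes_in_image[OF p(1)] permutes_in_image[OF p(2)] ij by auto
  then have "pseudo_skeleton M a c (perm_mat m \<pi>) (perm_mat n \<tau>) $$ (\<pi> i, \<tau> j) = Y $$ (i, j)"
    unfolding ps using permutes_inverses[OF p(1)] permutes_inverses[OF p(2)] by simp
  also have "\<dots> = (F * (?X * G)) $$ (i, j)" unfolding Y_def by (simp only: assoc_mult_mat[OF F X G])
  also have "\<dots> = row F i \<bullet> (?X *\<^sub>v col G j)"
    using F G X ij col_mult2[OF X G ij(2)] by (simp del: col_mult2)
  also have "row F i = vec c (\<lambda>k. M $$ (\<pi> i, \<tau> k))"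
    using ij unfolding F_def by (intro eq_vecI) auto
  also have "col G j = vec a (\<lambda>l. M $$ (\<pi> l, \<tau> j))"
    using ij unfolding G_def by (intro eq_vecI) auto
  finally show "pseudo_skeleton M a c (perm_mat m \<pi>) (perm_mat n \<tau>) $$ (\<pi> i, \<tau> j) =
     vec c (\<lambda>k. M $$ (\<pi> i, \<tau> k)) \<bullet> (?X *\<^sub>v vec a (\<lambda>l. M $$ (\<pi> l, \<tau> j)))" .
qed

lemma select_mat_cong:
  assumes "\<And>i. i < a \<Longrightarrow> f i = f' i" "\<And>j. j < c \<Longrightarrow> g j = g' j"
  shows "select_mat M a c f g = select_mat M a c f' g'"
  using assms by (intro eq_matI) auto

section \<open>Maximal volume and the entrywise error\<close>

text \<open>Since \<open>M\<close> has rank at least \<open>r\<close>, some block has rank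
  \<open>r\<close>, and lexicographic maximality forces this rank on the chosen block. Competing
  blocks either have Gram determinant 0 or have rank \<open>r\<close> too and lose the comparison of
  volumes.\<close>

lemma max_volume_pair_gram_det:
  fixes M :: "real mat"
  assumes M: "M \<in> carrier_mat m n" and p: "\<pi> permutes {..<m}" "\<tau> permutes {..<n}"
    and le: "r \<le> q" "r \<le> m" "q \<le> n" and rank: "r \<le> mat_rank M"
    and max: "max_volume_pair M r q (perm_mat m \<pi>) (perm_mat n \<tau>)"
  defines "V \<equiv> det (select_mat M r q \<pi> \<tau> * (select_mat M r q \<pi> \<tau>)\<^sup>T)"
  shows "V > 0"
    and "\<And>f g. inj_on f {..<r} \<Longrightarrow> f ` {..<r} \<subseteq> {..<m} \<Longrightarrow> inj_on g {..<q} \<Longrightarrow> g ` {..<q} \<subseteq> {..<n} \<Longrightarrow>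
      det (select_mat M r q f g * (select_mat M r q f g)\<^sup>T) \<le> V"
proof -
  let ?A = "select_mat M r q \<pi> \<tau>"
  let ?B = "\<lambda>f g. select_mat M r q f g"
  have block: "mat_rank (?B f g) < mat_rank ?A \<or>
      (mat_rank (?B f g) = mat_rank ?A \<and> volume (mat_rank ?A) (?B f g) \<le> volume (mat_rank ?A) ?A)"
    if fg: "inj_on f {..<r}" "f ` {..<r} \<subseteq> {..<m}" "inj_on g {..<q}" "g ` {..<q} \<subseteq> {..<n}" for f g
  proof -
    obtain \<pi>' where p1: "\<pi>' permutes {..<m}" "\<And>i. i < r \<Longrightarrow> \<pi>' i = f i"
      using inj_on_extends_to_permutation[OF fg(1,2)] by metis
    obtain \<tau>' where p2: "\<tau>' permutes {..<n}" "\<And>j. j < q \<Longrightarrow> \<tau>' j = g j"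
      using inj_on_extends_to_permutation[OF fg(3,4)] by metis
    have "permutation_mat (dim_row M) (perm_mat m \<pi>')" "permutation_mat (dim_col M) (perm_mat n \<tau>')"
      using M p1(1) p2(1) unfolding permutation_mat_iff by auto
    then have "mat_rank (?B \<pi>' \<tau>') < mat_rank ?A \<or>
      (mat_rank (?B \<pi>' \<tau>') = mat_rank ?A \<and> volume (mat_rank ?A) (?B \<pi>' \<tau>') \<le> volume (mat_rank ?A) ?A)"
      using max unfolding max_volume_pair_def Let_def
      using leading_block_perm_mat[OF M p le(2,3)] leading_block_perm_mat[OF M p1(1) p2(1) le(2,3)] by metis
    moreover have "?B \<pi>' \<tau>' = ?B f g" by (rule select_mat_cong[OF p1(2) p2(2)])
    ultimately show ?thesis by simp
  qed
  have vol: "volume r (?B f g) = sqrt (det (?B f g * (?B f g)\<^sup>T))" for f g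
    by (rule volume_eq_sqrt_gram_det[OF select_mat_carrier le(1)])
  obtain f g where f: "inj_on f {..<r}" "f ` {..<r} \<subseteq> {..<m}" and g: "inj_on g {..<r}" "g ` {..<r} \<subseteq> {..<n}"
    and dfg: "det (select_mat M r r f g * (select_mat M r r f g)\<^sup>T) \<noteq> 0"
    using nonsingular_square_submatrix[OF M rank] by blast
  \<comment> \<open>The nonsingular square block is padded to \<open>q\<close> columns by extending
    its column choice to a permutation.\<close>
  obtain g' where g': "g' permutes {..<n}" "\<And>j. j < r \<Longrightarrow> g' j = g j"
    using inj_on_extends_to_permutation[OF g] by metis
  have g'q: "inj_on g' {..<q}" "g' ` {..<q} \<subseteq> {..<n}"
    using permutes_inj_on[OF g'(1)] permutes_in_image[OF g'(1)] le(3) by auto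
  have d': "det (?B f g' * (?B f g')\<^sup>T) \<noteq> 0"
    by (rule gram_det_nonzero_more_columns[OF dfg le(1) g'(2)])
  have "mat_rank (?B f g') = r"
    by (rule mat_rank_eq_if_gram_det_nonzero[OF select_mat_carrier le(1) d'])
  then have rk: "mat_rank ?A = r"
    using block[OF f g'q] mat_rank_le_dims(1)[OF select_mat_carrier, of M r q \<pi> \<tau>] by linarith
  show bound: "det (?B f g * (?B f g)\<^sup>T) \<le> V"
    if fg: "inj_on f {..<r}" "f ` {..<r} \<subseteq> {..<m}" "inj_on g {..<q}" "g ` {..<q} \<subseteq> {..<n}" for f g
  proof (cases "det (?B f g * (?B f g)\<^sup>T) = 0")
    case True
    then show ?thesis using gram_det_nonneg[OF select_mat_carrier] unfolding V_def by metis
  next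
    case False
    then have "mat_rank (?B f g) = r" by (rule mat_rank_eq_if_gram_det_nonzero[OF select_mat_carrier le(1)])
    then have "volume r (?B f g) \<le> volume r ?A" using block[OF fg] rk by simp
    then show ?thesis unfolding vol V_def by simp
  qed
  have "det (?B f g' * (?B f g')\<^sup>T) > 0"
    using d' gram_det_nonneg[OF select_mat_carrier, of M r q f g'] by linarith
  then show "V > 0" using bound[OF f g'q] by linarith
qed

lemma permutes_upd_inj_on:
  assumes p: "\<pi> permutes {..<m}" and i: "r \<le> i" "i < m"
  shows "inj_on (\<pi>(r := \<pi> i)) {..<Suc r}" "(\<pi>(r := \<pi> i)) ` {..<Suc r} \<subseteq> {..<m :: nat}"
proof -
  have inj: "\<pi> x = \<pi> y \<longleftrightarrow> x = y" for x y using permutes_inj[OF p] by (auto dest: injD)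
  have lt: "\<pi> x < m \<longleftrightarrow> x < m" for x using permutes_in_image[OF p, of x] by simp
  show "inj_on (\<pi>(r := \<pi> i)) {..<Suc r}"
    by (rule inj_onI) (use i in \<open>auto simp: inj split: if_splits\<close>)
  show "(\<pi>(r := \<pi> i)) ` {..<Suc r} \<subseteq> {..<m}" using i by (auto simp: lt)
qed

text \<open>There are three cases. For \<open>i < r\<close> the skeleton reproduces the rows of
  \<open>A\<close> and the error is 0. For \<open>i \<ge> r\<close> and \<open>j < q\<close> only a
  row is appended to \<open>A\<close>, and \<open>gram_det_ratio_bound\<close> applies with
  \<open>K = 1\<close>. Otherwise a row and a column are appended, and \<open>K\<close> is the
  factor from \<open>gram_column_deletion\<close>.\<close>

lemma max_volume_entry_error:
  fixes M :: "real mat"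
  assumes M: "M \<in> carrier_mat m n" and p: "\<pi> permutes {..<m}" "\<tau> permutes {..<n}"
    and le: "r \<le> q" "r < m" "q \<le> n" and ij: "i < m" "j < n"
  defines "A \<equiv> select_mat M r q \<pi> \<tau>"
  defines "V \<equiv> det (A * A\<^sup>T)"
  defines "e \<equiv> vec q (\<lambda>k. M $$ (\<pi> i, \<tau> k)) \<bullet> (pseudo_inverse A *\<^sub>v vec r (\<lambda>l. M $$ (\<pi> l, \<tau> j))) - M $$ (\<pi> i, \<tau> j)"
  assumes V: "V > 0"
    and max: "\<And>f g. inj_on f {..<r} \<Longrightarrow> f ` {..<r} \<subseteq> {..<m} \<Longrightarrow> inj_on g {..<q} \<Longrightarrow> g ` {..<q} \<subseteq> {..<n} \<Longrightarrow>
      det (select_mat M r q f g * (select_mat M r q f g)\<^sup>T) \<le> V"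
  shows "e\<^sup>2 * (\<Sum>k<Suc r. 1 / eigs (M * M\<^sup>T) ! k) \<le> real (Suc r) * (real (Suc q) / (real (Suc q) - real r))"
proof -
  have A: "A \<in> carrier_mat r q" unfolding A_def by simp
  let ?G = "A * A\<^sup>T"
  have G: "?G \<in> carrier_mat r r" using A by simp
  have "det ?G \<noteq> 0" using V unfolding V_def by simp
  then obtain H where H: "H \<in> carrier_mat r r" "?G * H = 1\<^sub>m r" using det_nonzero_inverse[OF G] by metis
  have Ht: "H\<^sup>T = H" by (rule inverse_symmetric[OF G gram_symmetric H])
  define X where "X = A\<^sup>T * H"
  have X: "X \<in> carrier_mat q r" unfolding X_def using A H by simp
  have pinv: "pseudo_inverse A = X" and AX: "A * X = 1\<^sub>m r" and XA: "(X * A)\<^sup>T = X * A"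
    using pseudo_inverse_full_row_rank[OF A H] unfolding X_def by auto
  define c where "c = vec q (\<lambda>k. M $$ (\<pi> i, \<tau> k))"
  define b where "b = vec r (\<lambda>l. M $$ (\<pi> l, \<tau> j))"
  have c: "c \<in> carrier_vec q" and b: "b \<in> carrier_vec r" unfolding c_def b_def by auto
  have e: "e = c \<bullet> (X *\<^sub>v b) - M $$ (\<pi> i, \<tau> j)" unfolding e_def pinv c_def b_def ..
  have Xb: "X *\<^sub>v b \<in> carrier_vec q" using X b by simp
  have AXb: "A *\<^sub>v (X *\<^sub>v b) = b" using assoc_mult_mat_vec[OF A X b] AX b by simp
  let ?K = "real (Suc q) / (real (Suc q) - real r)"
  have K1: "?K \<ge> 1" using le(1) by (simp add: field_simps)
  show ?thesis
  proof (cases "i < r")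
    case True
    then have "c = row A i" unfolding c_def A_def by (intro eq_vecI) auto
    then have "c \<bullet> (X *\<^sub>v b) = (A *\<^sub>v (X *\<^sub>v b)) $ i" using True A by simp
    then have "e = 0" unfolding e AXb using True by (simp add: b_def)
    moreover have "0 \<le> real (Suc r) * ?K" using K1 by (intro mult_nonneg_nonneg) linarith+
    ultimately show ?thesis by simp
  next
    case False
    define F where "F = \<pi>(r := \<pi> i)"
    have F: "inj_on F {..<Suc r}" "F ` {..<Suc r} \<subseteq> {..<m}"
      unfolding F_def using permutes_upd_inj_on[OF p(1) _ ij(1), of r] False by auto
    have FI: "inj_on (F \<circ> insert_index l) {..<r}" "(F \<circ> insert_index l) ` {..<r} \<subseteq> {..<m}" for l
    proof -
      have sub: "insert_index l ` {..<r} \<subseteq> {..<Suc r}" by (auto simp: insert_index_def)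
      show "inj_on (F \<circ> insert_index l) {..<r}"
        by (intro comp_inj_on insert_index_inj_on inj_on_subset[OF F(1) sub])
      show "(F \<circ> insert_index l) ` {..<r} \<subseteq> {..<m}" using sub F(2) by (auto simp: image_subset_iff)
    qed
    show ?thesis
    proof (cases "j < q")
      case True
      let ?D = "select_mat M (Suc r) q F \<tau>"
      have tq: "inj_on \<tau> {..<q}" "\<tau> ` {..<q} \<subseteq> {..<n}"
        using permutes_inj_on[OF p(2)] permutes_in_image[OF p(2)] le(3) by auto
      have bA: "b = A *\<^sub>v unit_vec q j"
        using True A unfolding b_def A_def by (intro eq_vecI) auto
      \<comment> \<open>The orthogonal projection of a unit vector onto the kernel of
        \<open>A\<close>. Therefore its squared norm equals its entry \<open>z $ j\<close> and is at
        most 1, while the appended row sends it to \<open>- e\<close>.\<close>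
      define z where "z = unit_vec q j - X *\<^sub>v b"
      have z: "z \<in> carrier_vec q" unfolding z_def using Xb by simp
      have Az: "A *\<^sub>v z = 0\<^sub>v r"
        unfolding z_def using mult_minus_distrib_mat_vec[OF A unit_vec_carrier Xb] AXb bA[symmetric] b by simp
      have R: "mat r q (\<lambda>(i, j). ?D $$ (i, j)) = A"
        unfolding A_def by (intro eq_matI) (auto simp: F_def)
      have Drow: "row ?D l = row A l" if "l < r" for l
        using that unfolding A_def by (intro eq_vecI) (auto simp: F_def)
      have orth: "row ?D l \<bullet> z = 0" if "l < r" for l
        using arg_cong[OF Az, of "\<lambda>v. v $ l"] that A unfolding Drow[OF that] by simp
      have Dr: "row ?D r = c" unfolding c_def by (intro eq_vecI) (auto simp: F_def)
      have "c \<bullet> z = c \<bullet> unit_vec q j - c \<bullet> (X *\<^sub>v b)"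
        unfolding z_def by (rule scalar_prod_minus_distrib[OF c unit_vec_carrier Xb])
      then have cz: "c \<bullet> z = - e" unfolding e using True c by (simp add: c_def)
      have "z \<bullet> (X *\<^sub>v b) = z \<bullet> ((X * A) *\<^sub>v unit_vec q j)"
        unfolding bA using assoc_mult_mat_vec[OF X A, of "unit_vec q j"] by simp
      also have "\<dots> = ((X * A) *\<^sub>v z) \<bullet> unit_vec q j"
        using scalar_prod_mult_mat_vec[of "X * A" q q z "unit_vec q j"] X A z XA by simp
      also have "(X * A) *\<^sub>v z = X *\<^sub>v (A *\<^sub>v z)" by (rule assoc_mult_mat_vec[OF X A z])
      also have "X *\<^sub>v (A *\<^sub>v z) = 0\<^sub>v q" unfolding Az using X by (intro eq_vecI) auto
      finally have "z \<bullet> (X *\<^sub>v b) = 0" by simp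
      moreover have "z \<bullet> z = z \<bullet> unit_vec q j - z \<bullet> (X *\<^sub>v b)"
        by (subst (2) z_def) (rule scalar_prod_minus_distrib[OF z unit_vec_carrier Xb])
      ultimately have zz: "z \<bullet> z = z $ j" using True z by simp
      have "(z $ j)\<^sup>2 \<le> z \<bullet> z"
        unfolding scalar_prod_self_sum using True z by (intro member_le_sum) auto
      then have "z $ j * z $ j \<le> z $ j * 1" unfolding zz by (simp add: power2_eq_square)
      moreover have "z $ j \<ge> 0" using zz scalar_prod_self_nonneg[of z] by simp
      ultimately have z1: "z \<bullet> z \<le> 1" unfolding zz
        by (cases "z $ j = 0") auto
      have "V * e\<^sup>2 \<le> det (?D * ?D\<^sup>T) * (z \<bullet> z)"
        using gram_border[OF select_mat_carrier[of M "Suc r" q F \<tau>] z orth] unfolding R Dr cz V_def by simp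
      also have "\<dots> \<le> det (?D * ?D\<^sup>T) * 1"
        by (intro mult_left_mono z1 gram_det_nonneg[OF select_mat_carrier])
      finally have border: "e\<^sup>2 * V \<le> det (?D * ?D\<^sup>T)" by (simp add: mult.commute)
      \<comment> \<open>No column was added, so each row deletion leaves an \<open>r\<close> by
        \<open>q\<close> submatrix, directly bounded by \<open>V\<close>.\<close>
      have "e\<^sup>2 * (\<Sum>k<Suc r. 1 / eigs (M * M\<^sup>T) ! k) \<le> real (Suc r) * 1"
        by (rule gram_det_ratio_bound[OF M F tq V _ _ border]) (use max[OF FI tq] in auto)
      also have "\<dots> \<le> real (Suc r) * ?K" using K1 by (intro mult_left_mono) auto
      finally show ?thesis .
    next
      case False
      define T where "T = \<tau>(q := \<tau> j)"
      have T: "inj_on T {..<Suc q}" "T ` {..<Suc q} \<subseteq> {..<n}"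
        unfolding T_def using permutes_upd_inj_on[OF p(2) _ ij(2), of q] False by auto
      have TI: "inj_on (T \<circ> insert_index l) {..<q}" "(T \<circ> insert_index l) ` {..<q} \<subseteq> {..<n}" for l
      proof -
        have sub: "insert_index l ` {..<q} \<subseteq> {..<Suc q}" by (auto simp: insert_index_def)
        show "inj_on (T \<circ> insert_index l) {..<q}"
          by (intro comp_inj_on insert_index_inj_on inj_on_subset[OF T(1) sub])
        show "(T \<circ> insert_index l) ` {..<q} \<subseteq> {..<n}" using sub T(2) by (auto simp: image_subset_iff)
      qed
      let ?D = "select_mat M (Suc r) (Suc q) F T"
      \<comment> \<open>The first \<open>r\<close> rows of \<open>?D\<close> annihilate this vector
        because \<open>X *\<^sub>v b\<close> solves \<open>A *\<^sub>v y = b\<close>, with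
        \<open>b\<close> the appended column; the last row gives \<open>- e\<close>.\<close>
      define z where "z = vec (Suc q) (\<lambda>k. if k < q then - (X *\<^sub>v b) $ k else 1)"
      have z: "z \<in> carrier_vec (Suc q)" unfolding z_def by simp
      define R where "R = select_mat M r (Suc q) \<pi> T"
      have R': "mat r (Suc q) (\<lambda>(i, j). ?D $$ (i, j)) = R"
        unfolding R_def by (intro eq_matI) (auto simp: F_def)
      have prod_z: "row ?D l \<bullet> z = M $$ (F l, \<tau> j) - (\<Sum>k<q. M $$ (F l, \<tau> k) * (X *\<^sub>v b) $ k)" if "l < Suc r" for l
        using that unfolding z_def by (simp add: scalar_prod_def atLeast0LessThan T_def sum_negf del: index_mult_mat_vec)
      have orth: "row ?D l \<bullet> z = 0" if "l < r" for l
      proof -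
        have "(A *\<^sub>v (X *\<^sub>v b)) $ l = row A l \<bullet> (X *\<^sub>v b)" using that A by simp
        also have "\<dots> = (\<Sum>k<q. M $$ (\<pi> l, \<tau> k) * (X *\<^sub>v b) $ k)"
          using that carrier_vecD[OF Xb] unfolding A_def
          by (simp add: scalar_prod_def atLeast0LessThan del: index_mult_mat_vec dim_mult_mat_vec)
        finally show ?thesis using that prod_z[of l] unfolding AXb by (simp add: b_def F_def)
      qed
      have "c \<bullet> (X *\<^sub>v b) = (\<Sum>k<q. M $$ (\<pi> i, \<tau> k) * (X *\<^sub>v b) $ k)"
        using carrier_vecD[OF Xb] unfolding c_def
        by (simp add: scalar_prod_def atLeast0LessThan del: index_mult_mat_vec dim_mult_mat_vec)
      then have De: "row ?D r \<bullet> z = - e" using prod_z[of r] unfolding e by (simp add: F_def)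
      have zz: "z \<bullet> z = 1 + b \<bullet> (H *\<^sub>v b)"
      proof -
        have "z \<bullet> z = 1 + (X *\<^sub>v b) \<bullet> (X *\<^sub>v b)"
          unfolding scalar_prod_self_sum carrier_vecD[OF z] carrier_vecD[OF Xb] unfolding z_def by simp
        also have "(X *\<^sub>v b) \<bullet> (X *\<^sub>v b) = (X\<^sup>T *\<^sub>v (X *\<^sub>v b)) \<bullet> b"
          by (rule scalar_prod_mult_mat_vec[OF X Xb b])
        also have "X\<^sup>T = H * A"
          unfolding X_def using transpose_mult[of "A\<^sup>T" q r H r] A H Ht by simp
        also have "(H * A) *\<^sub>v (X *\<^sub>v b) = H *\<^sub>v b"
          using assoc_mult_mat_vec[OF H(1) A Xb] AXb by simp
        also have "(H *\<^sub>v b) \<bullet> b = b \<bullet> (H *\<^sub>v b)" using H(1) b by (intro comm_scalar_prod) auto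
        finally show ?thesis .
      qed
      have RR: "R * R\<^sup>T = ?G + mat r r (\<lambda>(k, l). 1 * b $ k * b $ l)"
        unfolding R_def A_def b_def by (intro eq_matI) (auto simp: scalar_prod_def atLeast0LessThan T_def)
      \<comment> \<open>Appending \<open>b\<close> to \<open>A\<close> multiplies the Gram
        determinant by exactly the squared norm of \<open>z\<close>, so this factor cancels in
        \<open>gram_border\<close>.\<close>
      have detR: "det (R * R\<^sup>T) = V * (z \<bullet> z)"
        unfolding RR det_rank_one_update[OF G H b] zz V_def by simp
      have zpos: "z \<bullet> z > 0"
      proof -
        have "z \<noteq> 0\<^sub>v (Suc q)" unfolding z_def by (auto dest!: arg_cong[of _ _ "\<lambda>v. v $ q"])
        then show ?thesis using scalar_prod_self_eq_0[OF z] scalar_prod_self_nonneg[of z] by linarith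
      qed
      have "V * (z \<bullet> z) * e\<^sup>2 \<le> det (?D * ?D\<^sup>T) * (z \<bullet> z)"
        using gram_border[OF select_mat_carrier[of M "Suc r" "Suc q" F T] z orth] unfolding R' De detR by simp
      then have "(e\<^sup>2 * V) * (z \<bullet> z) \<le> det (?D * ?D\<^sup>T) * (z \<bullet> z)" by (simp only: ac_simps)
      then have border: "e\<^sup>2 * V \<le> det (?D * ?D\<^sup>T)" using zpos by simp
      \<comment> \<open>After a row deletion \<open>q + 1\<close> columns remain; deleting each in
        turn gives \<open>q + 1\<close> competitors of \<open>A\<close>, each with Gram determinant
        at most \<open>V\<close>.\<close>
      have row_del: "det (select_mat M r (Suc q) (F \<circ> insert_index l) T * (select_mat M r (Suc q) (F \<circ> insert_index l) T)\<^sup>T) \<le> ?K * V" for l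
      proof -
        let ?N = "select_mat M r (Suc q) (F \<circ> insert_index l) T"
        have D: "mat r q (\<lambda>(i, j). ?N $$ (i, insert_index k j)) = select_mat M r q (F \<circ> insert_index l) (T \<circ> insert_index k)" for k
          by (rule eq_matI) (auto simp: insert_index_def)
        have "(real (Suc q) - real r) * det (?N * ?N\<^sup>T) \<le> (\<Sum>k<Suc q. V)"
          using gram_column_deletion[OF select_mat_carrier[of M r "Suc q" "F \<circ> insert_index l" T]] unfolding D
          by (rule order_trans) (intro sum_mono max FI TI)
        then show ?thesis using le(1) by (simp add: field_simps)
      qed
      show ?thesis
        by (rule gram_det_ratio_bound[OF M F T V _ row_del border]) (use K1 in simp)
    qed
  qed
qed

section \<open>Decay of the singular values and the final estimate\<close>

text \<open>The left side is the integral of \<open>x powr t\<close> up to \<open>N\<close>. Each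
  increment is bounded by the mean value theorem and monotonicity; the first is treated apart
  because the derivative rule is used at positive points only.\<close>

lemma sum_powr_ge:
  fixes t :: real
  assumes t: "0 \<le> t"
  shows "real N powr (t + 1) / (t + 1) \<le> (\<Sum>k=1..N. real k powr t)"
proof (induction N)
  case 0
  then show ?case by simp
next
  case (Suc N)
  have "real (Suc N) powr (t + 1) - real N powr (t + 1) \<le> (t + 1) * real (Suc N) powr t"
  proof (cases "N = 0")
    case True
    then show ?thesis using t by simp
  next
    case False
    have "\<exists>z. real N < z \<and> z < real (Suc N) \<and>
        real (Suc N) powr (t + 1) - real N powr (t + 1) = (real (Suc N) - real N) * ((t + 1) * z powr t)"
    proof (rule MVT2)
      fix x assume "real N \<le> x" "x \<le> real (Suc N)"
      then have "x > 0" using False by linarith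
      then show "((\<lambda>x. x powr (t + 1)) has_real_derivative (t + 1) * x powr t) (at x)"
        using has_real_derivative_powr[of x "t + 1"] by simp
    qed simp
    then obtain z where z: "real N < z" "z < real (Suc N)"
      and eq: "real (Suc N) powr (t + 1) - real N powr (t + 1) = (t + 1) * z powr t" by auto
    have "z powr t \<le> real (Suc N) powr t" using z t by (intro powr_mono2) auto
    then show ?thesis unfolding eq using t by (intro mult_left_mono) auto
  qed
  then have "real (Suc N) powr (t + 1) / (t + 1) - real N powr (t + 1) / (t + 1) \<le> real (Suc N) powr t"
    using t by (simp add: pos_divide_le_eq mult.commute flip: diff_divide_distrib)
  then show ?case using Suc.IH by simp
qed

lemma chebyshev_norm_attained:
  assumes "X \<in> carrier_mat m n" "0 < m" "0 < n"
  obtains i j where "i < m" "j < n" "chebyshev_norm X = \<bar>X $$ (i, j)\<bar>"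
proof -
  let ?S = "(\<lambda>(i, j). \<bar>X $$ (i, j)\<bar>) ` ({..<dim_row X} \<times> {..<dim_col X})"
  have "Max ?S \<in> ?S" using assms by (intro Max_in) auto
  then show ?thesis using that assms unfolding chebyshev_norm_def by auto
qed

theorem corollary3:
  fixes M Mhat :: "real mat" and m n r q :: nat and \<alpha> s C1 C2 :: real
  assumes "M \<in> carrier_mat m n"
    and "1 \<le> r"
    and "r + 1 \<le> mat_rank M"
    and "\<alpha> \<in> \<rat>" and "1 < \<alpha>"
    and "real q = \<alpha> * real r - 1"
    and "max_volume_approximation M r q Mhat"
    and "0 < C1" and "0 < C2" and "0 < s"
    and "\<And>k. 1 \<le> k \<Longrightarrow> k \<le> min m n \<Longrightarrow>
           C1 / real k powr (2 * s) \<le> (singular_value M k)\<^sup>2 \<and>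
           (singular_value M k)\<^sup>2 \<le> C2 / real k powr (2 * s)"
  shows "(chebyshev_norm (Mhat - M))\<^sup>2
           \<le> \<alpha> / (\<alpha> - 1) * (C2 / C1) * (2 * s + 1) * (singular_value M (r + 1))\<^sup>2"
proof -
  note M = assms(1) and sv = assms(11)
  have rm: "Suc r \<le> m" "Suc r \<le> n" using mat_rank_le_dims[OF M] assms(3) by auto
  \<comment> \<open>This gives \<open>q > r - 1\<close>, and integrality turns it into
    \<open>r \<le> q\<close>, so the block can have full row rank.\<close>
  have "real r < \<alpha> * real r" using assms(2,5) by simp
  then have rq: "r \<le> q" using assms(6) by linarith
  obtain P1 P2 where qn: "q \<le> n" and max: "max_volume_pair M r q P1 P2" and Mhat: "Mhat = pseudo_skeleton M r q P1 P2"
    using assms(7) M unfolding max_volume_approximation_def by auto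
  obtain \<pi> \<tau> where p: "\<pi> permutes {..<m}" "\<tau> permutes {..<n}" and P: "P1 = perm_mat m \<pi>" "P2 = perm_mat n \<tau>"
    using max M unfolding max_volume_pair_def permutation_mat_iff by auto
  let ?A = "select_mat M r q \<pi> \<tau>"
  have "r \<le> m" "r \<le> mat_rank M" using rm assms(3) by auto
  note gram = max_volume_pair_gram_det[OF M p rq this(1) qn this(2) max[unfolded P]]
  have X: "pseudo_inverse ?A \<in> carrier_mat q r"
  proof -
    have G: "?A * ?A\<^sup>T \<in> carrier_mat r r" by (rule mult_carrier_mat[of _ _ q]) auto
    obtain H where H: "H \<in> carrier_mat r r" "?A * ?A\<^sup>T * H = 1\<^sub>m r"
      using det_nonzero_inverse[OF G] gram(1) by (metis less_irrefl)
    show ?thesis unfolding pseudo_inverse_full_row_rank(1)[OF select_mat_carrier H] using H(1)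
      by (intro mult_carrier_mat[of _ q r]) auto
  qed
  note ps = pseudo_skeleton_perm_mat_index[OF M p \<open>r \<le> m\<close> qn _ _ X, folded P, folded Mhat]
  have "Mhat - M \<in> carrier_mat m n" by (rule minus_carrier_mat[OF M])
  then obtain i' j' where ij': "i' < m" "j' < n" and cn: "chebyshev_norm (Mhat - M) = \<bar>(Mhat - M) $$ (i', j')\<bar>"
    using chebyshev_norm_attained[of "Mhat - M" m n] rm by auto
  \<comment> \<open>The position of the largest error is rewritten in permuted coordinates, where
    the skeleton's entries are known.\<close>
  obtain i j where ij: "i < m" "j < n" "i' = \<pi> i" "j' = \<tau> j"
    using ij' permutes_image[OF p(1)] permutes_image[OF p(2)] by (metis imageE lessThan_iff)
  define e where "e = Mhat $$ (\<pi> i, \<tau> j) - M $$ (\<pi> i, \<tau> j)"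
  have cn2: "(chebyshev_norm (Mhat - M))\<^sup>2 = e\<^sup>2"
    using cn ij' M unfolding e_def ij(3,4) by simp
  define S where "S = (\<Sum>k<Suc r. 1 / eigs (M * M\<^sup>T) ! k)"
  have "e\<^sup>2 * S \<le> real (Suc r) * (real (Suc q) / (real (Suc q) - real r))"
    unfolding S_def e_def ps(2)[OF ij(1,2)]
    by (rule max_volume_entry_error[OF M p rq _ qn ij(1,2) gram]) (use rm in auto)
  \<comment> \<open>Here \<open>q + 1\<close> is \<open>\<alpha> * r\<close>, so \<open>r\<close>
    cancels from the quotient; this is why \<open>q\<close> is one less than
    \<open>\<alpha> * r\<close>.\<close>
  also have "real (Suc q) / (real (Suc q) - real r) = \<alpha> / (\<alpha> - 1)"
    using assms(2,5,6) by (simp add: field_simps)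
  finally have eS: "e\<^sup>2 * S \<le> real (Suc r) * (\<alpha> / (\<alpha> - 1))" .
  let ?t = "2 * s" and ?R = "real (Suc r)"
  have eig: "eigs (M * M\<^sup>T) ! k = (singular_value M (Suc k))\<^sup>2" if "k < Suc r" for k
    using singular_value_eq[OF M, of k] gram_eigs_nonneg[OF M, of k] that rm by simp
  \<comment> \<open>A lower bound for \<open>S\<close>: the upper decay bound says that
    \<open>C2\<close> over the squared singular value with index \<open>k\<close> is at least
    \<open>k powr ?t\<close>.\<close>
  have "?R powr (?t + 1) / (?t + 1) \<le> (\<Sum>k=1..Suc r. real k powr ?t)"
    by (rule sum_powr_ge) (use assms(10) in simp)
  also have "\<dots> = (\<Sum>k<Suc r. real (Suc k) powr ?t)"
    by (simp add: sum.atLeast1_atMost_eq del: sum.cl_ivl_Suc sum.lessThan_Suc)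
  also have "\<dots> \<le> (\<Sum>k<Suc r. C2 * (1 / eigs (M * M\<^sup>T) ! k))"
  proof (intro sum_mono)
    fix k assume "k \<in> {..<Suc r}"
    then have k: "k < Suc r" by simp
    let ?x = "real (Suc k) powr ?t"
    have x: "?x > 0" by simp
    have b: "C1 / ?x \<le> (singular_value M (Suc k))\<^sup>2" "(singular_value M (Suc k))\<^sup>2 \<le> C2 / ?x"
      using sv[of "Suc k"] k rm by auto
    \<comment> \<open>The lower decay bound makes the singular value nonzero, so that the upper one
      may be inverted.\<close>
    have "0 < C1 / ?x" using x assms(8) by simp
    then have "(singular_value M (Suc k))\<^sup>2 > 0" using b(1) by linarith
    then show "?x \<le> C2 * (1 / eigs (M * M\<^sup>T) ! k)"
      unfolding eig[OF k] using b(2) x by (simp add: field_simps)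
  qed
  also have "\<dots> = C2 * S" unfolding S_def by (simp add: sum_distrib_left del: sum.lessThan_Suc)
  finally have S: "?R powr (?t + 1) / (?t + 1) \<le> C2 * S" .
  have \<sigma>: "C1 / ?R powr ?t \<le> (singular_value M (r + 1))\<^sup>2"
    using sv[of "r + 1"] rm by simp
  have Rt: "?R powr (?t + 1) = ?R powr ?t * ?R" by (simp add: powr_add)
  have "e\<^sup>2 * (?R powr (?t + 1) / (?t + 1)) \<le> e\<^sup>2 * (C2 * S)" by (intro mult_left_mono S) simp
  also have "\<dots> = C2 * (e\<^sup>2 * S)" by simp
  also have "\<dots> \<le> C2 * (?R * (\<alpha> / (\<alpha> - 1)))" using eS assms(9) by (intro mult_left_mono) auto
  \<comment> \<open>One factor \<open>?R\<close> of the power cancels against the number of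
    principal minors, leaving \<open>?R powr ?t\<close>.\<close>
  finally have "?R * (e\<^sup>2 * ?R powr ?t / (?t + 1)) \<le> ?R * (C2 * (\<alpha> / (\<alpha> - 1)))"
    unfolding Rt by (simp only: ac_simps times_divide_eq_right times_divide_eq_left)
  then have "e\<^sup>2 * ?R powr ?t / (?t + 1) \<le> C2 * (\<alpha> / (\<alpha> - 1))"
    by (rule mult_left_le_imp_le) simp
  then have "e\<^sup>2 * ?R powr ?t \<le> C2 * (\<alpha> / (\<alpha> - 1)) * (?t + 1)"
    using assms(10) by (simp only: pos_divide_le_eq)
  then have "e\<^sup>2 \<le> \<alpha> / (\<alpha> - 1) * C2 * (?t + 1) / ?R powr ?t"
    by (subst pos_le_divide_eq) (simp_all add: ac_simps)
  \<comment> \<open>Introducing \<open>C1 / C1\<close> exposes \<open>C1 / ?R powr ?t\<close>, the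
    lower decay bound at index \<open>r + 1\<close>.\<close>
  also have "\<dots> = \<alpha> / (\<alpha> - 1) * (C2 / C1) * (?t + 1) * (C1 / ?R powr ?t)"
    using assms(8) by simp
  also have "\<dots> \<le> \<alpha> / (\<alpha> - 1) * (C2 / C1) * (?t + 1) * (singular_value M (r + 1))\<^sup>2"
    using assms(5,8,9,10) by (intro mult_left_mono \<sigma>) auto
  finally show ?thesis unfolding cn2 .
qed

end
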